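(* If $T$ is a continuous-logic theory expanding $\mathsf{MLO}$ such that all models of $T$ are weakly o-minimal, then $T$ is distal.
   Context: $\mathsf{MLO}$ is the theory (in a language containing $r$) whose models are exactly complete metric linear orders of diameter $\le 1$: a linear order $\le$ and metric $d$ such that every open ball is order-convex, with $r(x,y)=\inf_{z\le y}d(x,z)$. A model $M$ is weakly o-minimal if the interpretation of every definable predicate with parameters in one variable is a uniform limit of functions in the $\mathbb{R}$-linear span of characteristic functions of order-convex subsets of $M$. Distality is in the usual sense for continuous logic: $T$ is distal if whenever $I_1+a+I_2$ is an indiscernible sequence (with $I_1,I_2$ infinite without endpoints at the cut) and $I_1+I_2$ is indiscernible over a set $B$, then $I_1+a+I_2$ is indiscernible over $B$. *)

theory Defs
  imports "HOL-Analysis.Analysis"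
begin

section \<open>Continuous first-order logic\<close>

text \<open>We use the \<open>[0,1]\<close>-valued presentation with structures of diameter at most 1.  The
  modulus of a symbol \<open>s\<close> maps \<open>\<epsilon> > 0\<close> to \<open>\<Delta> s \<epsilon> > 0\<close>; the metric is a logical symbol.\<close>

record ('f, 'p) cl_lang =
  Funs :: "'f set"
  Preds :: "'p set"
  farity :: "'f \<Rightarrow> nat"
  parity :: "'p \<Rightarrow> nat"
  fmodulus :: "'f \<Rightarrow> real \<Rightarrow> real"
  pmodulus :: "'p \<Rightarrow> real \<Rightarrow> real"

definition is_lang :: "('f, 'p) cl_lang \<Rightarrow> bool" where
  "is_lang L \<longleftrightarrow>
     (\<forall>f\<in>Funs L. \<forall>\<epsilon>>0. fmodulus L f \<epsilon> > 0) \<and> (\<forall>p\<in>Preds L. \<forall>\<epsilon>>0. pmodulus L p \<epsilon> > 0)"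

datatype 'f cl_term = Var nat | Fn 'f "'f cl_term list"

datatype ('f, 'p) cl_fm =
    Pred 'p "'f cl_term list"
  | Dist "'f cl_term" "'f cl_term"
  | Conn "real list \<Rightarrow> real" "('f, 'p) cl_fm list"
  | SupQ nat "('f, 'p) cl_fm"
  | InfQ nat "('f, 'p) cl_fm"

text \<open>The \<open>n\<close>-ary connectives are all continuous functions from \<open>[0,1]^n\<close> to \<open>[0,1]\<close>.
  Continuity is expressed on \<open>[0,1]^\<nat>\<close> with the product topology, for the function that only
  depends on the first \<open>n\<close> coordinates.\<close>

definition connective :: "nat \<Rightarrow> (real list \<Rightarrow> real) \<Rightarrow> bool" where
  "connective n u \<longleftrightarrow>
     (\<forall>xs. length xs = n \<and> set xs \<subseteq> {0..1} \<longrightarrow> u xs \<in> {0..1}) \<and>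
     continuous_on {x :: nat \<Rightarrow> real. range x \<subseteq> {0..1}} (\<lambda>x. u (map x [0..<n]))"

fun wf_term :: "('f, 'p) cl_lang \<Rightarrow> 'f cl_term \<Rightarrow> bool" where
  "wf_term L (Var x) \<longleftrightarrow> True"
| "wf_term L (Fn f ts) \<longleftrightarrow> f \<in> Funs L \<and> length ts = farity L f \<and> (\<forall>t\<in>set ts. wf_term L t)"

fun wf_fm :: "('f, 'p) cl_lang \<Rightarrow> ('f, 'p) cl_fm \<Rightarrow> bool" where
  "wf_fm L (Pred p ts) \<longleftrightarrow> p \<in> Preds L \<and> length ts = parity L p \<and> (\<forall>t\<in>set ts. wf_term L t)"
| "wf_fm L (Dist s t) \<longleftrightarrow> wf_term L s \<and> wf_term L t"
| "wf_fm L (Conn u \<phi>s) \<longleftrightarrow> connective (length \<phi>s) u \<and> (\<forall>\<phi>\<in>set \<phi>s. wf_fm L \<phi>)"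
| "wf_fm L (SupQ x \<phi>) \<longleftrightarrow> wf_fm L \<phi>"
| "wf_fm L (InfQ x \<phi>) \<longleftrightarrow> wf_fm L \<phi>"

fun tvars :: "'f cl_term \<Rightarrow> nat set" where
  "tvars (Var x) = {x}"
| "tvars (Fn f ts) = (\<Union>t\<in>set ts. tvars t)"

fun fvars :: "('f, 'p) cl_fm \<Rightarrow> nat set" where
  "fvars (Pred p ts) = (\<Union>t\<in>set ts. tvars t)"
| "fvars (Dist s t) = tvars s \<union> tvars t"
| "fvars (Conn u \<phi>s) = (\<Union>\<phi>\<in>set \<phi>s. fvars \<phi>)"
| "fvars (SupQ x \<phi>) = fvars \<phi> - {x}"
| "fvars (InfQ x \<phi>) = fvars \<phi> - {x}"

record ('f, 'p, 'm) cl_struct =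
  met :: "'m metric"
  fint :: "'f \<Rightarrow> 'm list \<Rightarrow> 'm"
  pint :: "'p \<Rightarrow> 'm list \<Rightarrow> real"

abbreviation univ :: "('f, 'p, 'm) cl_struct \<Rightarrow> 'm set" where
  "univ M \<equiv> mspace (met M)"

definition tuples :: "('f, 'p, 'm) cl_struct \<Rightarrow> nat \<Rightarrow> 'm list set" where
  "tuples M n = {xs. length xs = n \<and> set xs \<subseteq> univ M}"

definition close_tuples :: "('f, 'p, 'm) cl_struct \<Rightarrow> real \<Rightarrow> 'm list \<Rightarrow> 'm list \<Rightarrow> bool" where
  "close_tuples M \<delta> xs ys \<longleftrightarrow> list_all2 (\<lambda>x y. mdist (met M) x y < \<delta>) xs ys"

definition is_struct :: "('f, 'p) cl_lang \<Rightarrow> ('f, 'p, 'm) cl_struct \<Rightarrow> bool" where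
  "is_struct L M \<longleftrightarrow>
     univ M \<noteq> {} \<and> mcomplete_of (met M) \<and>
     (\<forall>x\<in>univ M. \<forall>y\<in>univ M. mdist (met M) x y \<le> 1) \<and>
     (\<forall>f\<in>Funs L. (\<forall>xs\<in>tuples M (farity L f). fint M f xs \<in> univ M) \<and>
        (\<forall>\<epsilon>>0. \<forall>xs\<in>tuples M (farity L f). \<forall>ys\<in>tuples M (farity L f).
           close_tuples M (fmodulus L f \<epsilon>) xs ys \<longrightarrow>
           mdist (met M) (fint M f xs) (fint M f ys) \<le> \<epsilon>)) \<and>
     (\<forall>p\<in>Preds L. (\<forall>xs\<in>tuples M (parity L p). pint M p xs \<in> {0..1}) \<and>
        (\<forall>\<epsilon>>0. \<forall>xs\<in>tuples M (parity L p). \<forall>ys\<in>tuples M (parity L p).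
           close_tuples M (pmodulus L p \<epsilon>) xs ys \<longrightarrow>
           \<bar>pint M p xs - pint M p ys\<bar> \<le> \<epsilon>))"

fun teval :: "('f, 'p, 'm) cl_struct \<Rightarrow> (nat \<Rightarrow> 'm) \<Rightarrow> 'f cl_term \<Rightarrow> 'm" where
  "teval M e (Var x) = e x"
| "teval M e (Fn f ts) = fint M f (map (teval M e) ts)"

fun feval :: "('f, 'p, 'm) cl_struct \<Rightarrow> (nat \<Rightarrow> 'm) \<Rightarrow> ('f, 'p) cl_fm \<Rightarrow> real" where
  "feval M e (Pred p ts) = pint M p (map (teval M e) ts)"
| "feval M e (Dist s t) = mdist (met M) (teval M e s) (teval M e t)"
| "feval M e (Conn u \<phi>s) = u (map (feval M e) \<phi>s)"
| "feval M e (SupQ x \<phi>) = (SUP m\<in>univ M. feval M (e(x := m)) \<phi>)"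
| "feval M e (InfQ x \<phi>) = (INF m\<in>univ M. feval M (e(x := m)) \<phi>)"

text \<open>\<open>value_at M \<phi> [a\<^sub>0, \<dots>, a\<^sub>k]\<close> is the value of \<open>\<phi>(a\<^sub>0, \<dots>, a\<^sub>k)\<close>; it is only used when
  all free variables of \<open>\<phi>\<close> are among \<open>x\<^sub>0, \<dots>, x\<^sub>k\<close>.\<close>

definition fm_in :: "('f, 'p) cl_lang \<Rightarrow> nat \<Rightarrow> ('f, 'p) cl_fm \<Rightarrow> bool" where
  "fm_in L n \<phi> \<longleftrightarrow> wf_fm L \<phi> \<and> fvars \<phi> \<subseteq> {..<n}"

definition value_at :: "('f, 'p, 'm) cl_struct \<Rightarrow> ('f, 'p) cl_fm \<Rightarrow> 'm list \<Rightarrow> real" where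
  "value_at M \<phi> xs = feval M (\<lambda>i. xs ! i) \<phi>"

text \<open>A theory is a set of sentences \<open>\<phi>\<close>, standing for the closed conditions \<open>\<phi> = 0\<close>.\<close>

definition is_theory :: "('f, 'p) cl_lang \<Rightarrow> ('f, 'p) cl_fm set \<Rightarrow> bool" where
  "is_theory L T \<longleftrightarrow> (\<forall>\<phi>\<in>T. fm_in L 0 \<phi>)"

definition is_model ::
  "('f, 'p) cl_lang \<Rightarrow> ('f, 'p) cl_fm set \<Rightarrow> ('f, 'p, 'm) cl_struct \<Rightarrow> bool" where
  "is_model L T M \<longleftrightarrow> is_struct L M \<and> (\<forall>\<phi>\<in>T. value_at M \<phi> [] = 0)"

section \<open>Metric linear orders\<close>

definition order_convex :: "'m set \<Rightarrow> 'm rel \<Rightarrow> 'm set \<Rightarrow> bool" where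
  "order_convex X R C \<longleftrightarrow>
     C \<subseteq> X \<and> (\<forall>x\<in>C. \<forall>y\<in>C. \<forall>z\<in>X. (x, z) \<in> R \<and> (z, y) \<in> R \<longrightarrow> z \<in> C)"

definition metric_linear_order :: "'m metric \<Rightarrow> 'm rel \<Rightarrow> bool" where
  "metric_linear_order D R \<longleftrightarrow>
     linear_order_on (mspace D) R \<and>
     (\<forall>x\<in>mspace D. \<forall>\<epsilon>>0. order_convex (mspace D) R (mball_of D x \<epsilon>))"

text \<open>\<open>MLO_order r M R\<close>: with the order \<open>R\<close>, the reduct of \<open>M\<close> to the language \<open>{r}\<close> is a metric
  linear order with \<open>r(x,y) = inf {d(x,z) | z \<le> y}\<close>.  Completeness and the bound on the diameter
  are part of being a structure.  At most one \<open>R\<close> satisfies this, since \<open>x \<le> y\<close> iff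
  \<open>r(x,y) = 0\<close>.\<close>

definition MLO_order :: "'p \<Rightarrow> ('f, 'p, 'm) cl_struct \<Rightarrow> 'm rel \<Rightarrow> bool" where
  "MLO_order r M R \<longleftrightarrow>
     metric_linear_order (met M) R \<and>
     (\<forall>x\<in>univ M. \<forall>y\<in>univ M.
        pint M r [x, y] = (INF z\<in>{z \<in> univ M. (z, y) \<in> R}. mdist (met M) x z))"

text \<open>\<open>T\<close> expands \<open>MLO\<close> if its language contains \<open>r\<close> and the \<open>{r}\<close>-reduct of each of its models
  is a model of \<open>MLO\<close>.  Since HOL cannot quantify over types inside a formula, here and below
  the models range over all structures whose universe is a subset of a type \<open>'m\<close>, which is a
  parameter.\<close>

definition expands_MLO ::
  "'m itself \<Rightarrow> ('f, 'p) cl_lang \<Rightarrow> 'p \<Rightarrow> ('f, 'p) cl_fm set \<Rightarrow> bool" where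
  "expands_MLO (_ :: 'm itself) L r T \<longleftrightarrow>
     r \<in> Preds L \<and> parity L r = 2 \<and>
     (\<forall>M :: ('f, 'p, 'm) cl_struct. is_model L T M \<longrightarrow> (\<exists>R. MLO_order r M R))"

section \<open>Weak o-minimality\<close>

definition definable_pred1 ::
  "('f, 'p) cl_lang \<Rightarrow> ('f, 'p, 'm) cl_struct \<Rightarrow> ('m \<Rightarrow> real) \<Rightarrow> bool" where
  "definable_pred1 L M P \<longleftrightarrow>
     (\<exists>(\<phi> :: nat \<Rightarrow> ('f, 'p) cl_fm) (bs :: nat \<Rightarrow> 'm list).
        (\<forall>n. set (bs n) \<subseteq> univ M \<and> fm_in L (Suc (length (bs n))) (\<phi> n)) \<and>
        uniform_limit (univ M) (\<lambda>n x. value_at M (\<phi> n) (x # bs n)) P sequentially)"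

definition convex_span :: "'m set \<Rightarrow> 'm rel \<Rightarrow> ('m \<Rightarrow> real) set" where
  "convex_span X R =
     {g. \<exists>(k :: nat) (c :: nat \<Rightarrow> real) (C :: nat \<Rightarrow> 'm set).
           (\<forall>i<k. order_convex X R (C i)) \<and> g = (\<lambda>x. \<Sum>i<k. c i * indicat_real (C i) x)}"

definition weakly_o_minimal ::
  "('f, 'p) cl_lang \<Rightarrow> 'm rel \<Rightarrow> ('f, 'p, 'm) cl_struct \<Rightarrow> bool" where
  "weakly_o_minimal L R M \<longleftrightarrow>
     (\<forall>P. definable_pred1 L M P \<longrightarrow>
        (\<exists>g :: nat \<Rightarrow> 'm \<Rightarrow> real. (\<forall>n. g n \<in> convex_span (univ M) R) \<and>
           uniform_limit (univ M) g P sequentially))"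

section \<open>Indiscernible sequences and distality\<close>

definition indiscernible ::
  "('f, 'p) cl_lang \<Rightarrow> ('f, 'p, 'm) cl_struct \<Rightarrow> 'm set \<Rightarrow> ('i::linorder) set \<Rightarrow> ('i \<Rightarrow> 'm list) \<Rightarrow> bool"
  where
  "indiscernible L M B J a \<longleftrightarrow>
     (\<forall>\<phi> bs us vs.
        set bs \<subseteq> B \<and> set us \<subseteq> J \<and> set vs \<subseteq> J \<and> length us = length vs \<and>
        sorted_wrt (<) us \<and> sorted_wrt (<) vs \<and>
        fm_in L (length (concat (map a us) @ bs)) \<phi> \<longrightarrow>
        value_at M \<phi> (concat (map a us) @ bs) = value_at M \<phi> (concat (map a vs) @ bs))"

text \<open>The sequence \<open>I\<^sub>1 + a + I\<^sub>2\<close> of \<open>n\<close>-tuples is indexed by \<open>I1 \<union> {c} \<union> I2\<close>, with \<open>I1 < c < I2\<close>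
  in a linear order \<open>'i\<close>; the member \<open>a\<close> is the one with index \<open>c\<close>.  Sequences range over
  all models of \<open>T\<close> instead of a monster model for each completion of \<open>T\<close>.\<close>

definition distal ::
  "'m itself \<Rightarrow> ('i::linorder) itself \<Rightarrow> ('f, 'p) cl_lang \<Rightarrow> ('f, 'p) cl_fm set \<Rightarrow> bool" where
  "distal (_ :: 'm itself) (_ :: 'i itself) L T \<longleftrightarrow>
     (\<forall>(M :: ('f, 'p, 'm) cl_struct) (I1 :: 'i set) (c :: 'i) (I2 :: 'i set) (n :: nat)
        (a :: 'i \<Rightarrow> 'm list) (B :: 'm set).
        is_model L T M \<and>
        infinite I1 \<and> infinite I2 \<and> (\<forall>i\<in>I1. i < c) \<and> (\<forall>i\<in>I2. c < i) \<and>
        (\<forall>i\<in>I1. \<exists>j\<in>I1. i < j) \<and> (\<forall>i\<in>I2. \<exists>j\<in>I2. j < i) \<and>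
        (\<forall>i \<in> I1 \<union> {c} \<union> I2. a i \<in> tuples M n) \<and> B \<subseteq> univ M \<and>
        indiscernible L M {} (I1 \<union> {c} \<union> I2) a \<and>
        indiscernible L M B (I1 \<union> I2) a
        \<longrightarrow> indiscernible L M B (I1 \<union> {c} \<union> I2) a)"

end

theory Submission
  imports Defs
begin

text \<open>Adding parameters one at a time, it suffices to treat one new parameter \<open>b\<close>.  Replace the
  member at the cut \<open>c\<close> by members at \<open>i < c < j\<close>, keep all other arguments of a formula fixed, and
  let \<open>f\<^sub>i, f\<^sub>c, f\<^sub>j\<close> be the resulting functions of the variable for which \<open>b\<close> is substituted.  Then
  \<open>f\<^sub>i(b) = f\<^sub>j(b)\<close>; suppose that \<open>f\<^sub>c(b)\<close> differs, and let \<open>\<mu>\<close> be the midpoint.  For each \<open>m\<close> the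
  elements that lie above a chain of length \<open>m\<close> along which \<open>f\<^sub>q\<close> alternates around \<open>\<mu>\<close> form a final
  segment, and by indiscernibility these segments are monotone in \<open>q\<close>.  Induction on \<open>m\<close> shows that
  \<open>b\<close> lies in all of them: at each step either \<open>b\<close> prolongs alternations of both \<open>f\<^sub>i\<close> and \<open>f\<^sub>j\<close>, and
  then lies in the next segment of \<open>f\<^sub>c\<close>, which is between the other two; or \<open>b\<close> prolongs an
  alternation of \<open>f\<^sub>c\<close>, and then lies in the next segment of \<open>f\<^sub>i\<close> or \<open>f\<^sub>j\<close>, hence of both, as \<open>i\<close> and
  \<open>j\<close> have the same type over \<open>b\<close>.  But by weak o-minimality the length of alternations of \<open>f\<^sub>i\<close> is
  bounded.\<close>

section \<open>Formulas and renaming of variables\<close>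

lemma teval_cong:
  "(\<And>v. v \<in> tvars t \<Longrightarrow> e v = e' v) \<Longrightarrow> teval M e t = teval M e' t"
proof (induction t)
  case (Fn f ts)
  then have "map (teval M e) ts = map (teval M e') ts"
    by auto
  then show ?case by (simp only: teval.simps)
qed simp

lemma feval_cong:
  "(\<And>v. v \<in> fvars \<phi> \<Longrightarrow> e v = e' v) \<Longrightarrow> feval M e \<phi> = feval M e' \<phi>"
proof (induction \<phi> arbitrary: e e')
  case (Pred p ts)
  then have "map (teval M e) ts = map (teval M e') ts"
    by (auto intro: teval_cong)
  then show ?case by (simp only: feval.simps)
next
  case (Dist s t)
  then show ?case by (auto intro!: arg_cong2[where f = "mdist (met M)"] teval_cong)
next
  case (Conn u \<phi>s)
  have "map (feval M e) \<phi>s = map (feval M e') \<phi>s"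
    by (intro map_cong refl Conn.IH) (use Conn.prems in auto)
  then show ?case by (simp only: feval.simps)
next
  case (SupQ x \<phi>)
  have "feval M (e(x := m)) \<phi> = feval M (e'(x := m)) \<phi>" for m
    by (rule SupQ.IH) (use SupQ.prems in auto)
  then show ?case by simp
next
  case (InfQ x \<phi>)
  have "feval M (e(x := m)) \<phi> = feval M (e'(x := m)) \<phi>" for m
    by (rule InfQ.IH) (use InfQ.prems in auto)
  then show ?case by simp
qed

lemma finite_tvars: "finite (tvars t)"
  by (induction t) auto

lemma finite_fvars: "finite (fvars \<phi>)"
  by (induction \<phi>) (auto simp: finite_tvars)

fun rename_term :: "(nat \<Rightarrow> nat) \<Rightarrow> 'f cl_term \<Rightarrow> 'f cl_term" where
  "rename_term \<sigma> (Var x) = Var (\<sigma> x)"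
| "rename_term \<sigma> (Fn f ts) = Fn f (map (rename_term \<sigma>) ts)"

lemma teval_rename_term: "teval M e (rename_term \<sigma> t) = teval M (e \<circ> \<sigma>) t"
  by (induction t) (auto simp: comp_def cong: map_cong)

lemma wf_rename_term: "wf_term L t \<Longrightarrow> wf_term L (rename_term \<sigma> t)"
  by (induction t) auto

lemma tvars_rename_term: "tvars (rename_term \<sigma> t) = \<sigma> ` tvars t"
  by (induction t) auto

definition fresh_for :: "nat set \<Rightarrow> nat" where
  "fresh_for V = (SOME z. z \<notin> V)"

lemma fresh_for_notin: "finite V \<Longrightarrow> fresh_for V \<notin> V"
  unfolding fresh_for_def by (rule someI_ex, rule ex_new_if_finite) simp

fun rename :: "(nat \<Rightarrow> nat) \<Rightarrow> ('f, 'p) cl_fm \<Rightarrow> ('f, 'p) cl_fm" where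
  "rename \<sigma> (Pred p ts) = Pred p (map (rename_term \<sigma>) ts)"
| "rename \<sigma> (Dist s t) = Dist (rename_term \<sigma> s) (rename_term \<sigma> t)"
| "rename \<sigma> (Conn u \<phi>s) = Conn u (map (rename \<sigma>) \<phi>s)"
| "rename \<sigma> (SupQ x \<phi>) =
     (let z = fresh_for (\<sigma> ` fvars \<phi>) in SupQ z (rename (\<sigma>(x := z)) \<phi>))"
| "rename \<sigma> (InfQ x \<phi>) =
     (let z = fresh_for (\<sigma> ` fvars \<phi>) in InfQ z (rename (\<sigma>(x := z)) \<phi>))"

lemma wf_rename: "wf_fm L \<phi> \<Longrightarrow> wf_fm L (rename \<sigma> \<phi>)"
  by (induction \<phi> arbitrary: \<sigma>) (auto simp: wf_rename_term Let_def)

lemma fvars_rename: "fvars (rename \<sigma> \<phi>) \<subseteq> \<sigma> ` fvars \<phi>"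
proof (induction \<phi> arbitrary: \<sigma>)
  case (SupQ x \<phi>)
  have "fvars (rename (\<sigma>(x := z)) \<phi>) - {z} \<subseteq> \<sigma> ` (fvars \<phi> - {x})" for z
    by (rule order_trans[OF Diff_mono[OF SupQ order_refl]]) auto
  then show ?case by (simp only: rename.simps Let_def fvars.simps)
next
  case (InfQ x \<phi>)
  have "fvars (rename (\<sigma>(x := z)) \<phi>) - {z} \<subseteq> \<sigma> ` (fvars \<phi> - {x})" for z
    by (rule order_trans[OF Diff_mono[OF InfQ order_refl]]) auto
  then show ?case by (simp only: rename.simps Let_def fvars.simps)
qed (fastforce simp: tvars_rename_term)+

lemma feval_fresh_fun_upd:
  "feval M (e(fresh_for (\<sigma> ` fvars \<phi>) := m) \<circ> \<sigma>(x := fresh_for (\<sigma> ` fvars \<phi>))) \<phi> =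
   feval M ((e \<circ> \<sigma>)(x := m)) \<phi>"
proof (rule feval_cong)
  fix v assume "v \<in> fvars \<phi>"
  moreover have "fresh_for (\<sigma> ` fvars \<phi>) \<notin> \<sigma> ` fvars \<phi>"
    by (simp add: fresh_for_notin finite_fvars)
  ultimately have "\<sigma> v \<noteq> fresh_for (\<sigma> ` fvars \<phi>)"
    by (metis imageI)
  then show "(e(fresh_for (\<sigma> ` fvars \<phi>) := m) \<circ> \<sigma>(x := fresh_for (\<sigma> ` fvars \<phi>))) v =
      ((e \<circ> \<sigma>)(x := m)) v"
    by simp
qed

lemma feval_rename: "feval M e (rename \<sigma> \<phi>) = feval M (e \<circ> \<sigma>) \<phi>"
proof (induction \<phi> arbitrary: \<sigma> e)
  case (Pred p ts)
  have "teval M e \<circ> rename_term \<sigma> = teval M (e \<circ> \<sigma>)"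
    by (rule ext) (simp add: teval_rename_term)
  then show ?case by (simp only: rename.simps feval.simps map_map)
next
  case (Conn u \<phi>s)
  have "map (\<lambda>\<phi>. feval M e (rename \<sigma> \<phi>)) \<phi>s = map (feval M (e \<circ> \<sigma>)) \<phi>s"
    by (intro map_cong refl Conn.IH)
  then show ?case by (simp only: rename.simps feval.simps map_map comp_def)
next
  case (SupQ x \<phi>)
  then show ?case by (simp only: rename.simps Let_def feval.simps feval_fresh_fun_upd)
next
  case (InfQ x \<phi>)
  then show ?case by (simp only: rename.simps Let_def feval.simps feval_fresh_fun_upd)
qed (simp add: teval_rename_term)

section \<open>Definable predicates\<close>

lemma continuous_on_coordinate: "continuous_on S (\<lambda>x :: nat \<Rightarrow> real. x i)"
  by (rule continuous_on_subset[OF continuous_on_product_coordinates subset_UNIV])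

lemma connective_unary:
  assumes "continuous_on {0..1} u" "u ` {0..1} \<subseteq> {0..1}"
  shows "connective (Suc 0) (\<lambda>xs. u (xs ! 0))"
proof -
  have "continuous_on {x :: nat \<Rightarrow> real. range x \<subseteq> {0..1}} (\<lambda>x. u (x 0))"
    by (rule continuous_on_compose2[OF assms(1) continuous_on_coordinate]) auto
  then show ?thesis
    using assms(2) unfolding connective_def by (auto simp: length_Suc_conv image_subset_iff)
qed

lemma connective_max: "connective (Suc (Suc 0)) (\<lambda>xs. max (xs ! 0) (xs ! 1))"
  unfolding connective_def
  by (auto simp: length_Suc_conv intro!: continuous_intros continuous_on_coordinate)

abbreviation adjoin :: "'v set \<Rightarrow> 'v option set" where
  "adjoin V \<equiv> insert None (Some ` V)"

definition slice :: "(('v option \<Rightarrow> 'm) \<Rightarrow> real) \<Rightarrow> ('v \<Rightarrow> 'm) \<Rightarrow> 'm \<Rightarrow> real" where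
  "slice F e x = F (case_option x e)"

lemma slice_comp_Some: "slice F (e \<circ> Some) (e None) = F e"
proof -
  have "case_option (e None) (e \<circ> Some) = e"
    by (auto split: option.split)
  then show ?thesis by (simp add: slice_def)
qed

lemma slice_map_option: "slice (\<lambda>e. F (e \<circ> map_option \<tau>)) e = slice F (e \<circ> \<tau>)"
proof
  fix x
  have "case_option x e \<circ> map_option \<tau> = case_option x (e \<circ> \<tau>)"
    by (auto split: option.split)
  then show "slice (\<lambda>e. F (e \<circ> map_option \<tau>)) e x = slice F (e \<circ> \<tau>) x"
    by (simp add: slice_def)
qed

lemma case_option_in_Pi: "e \<in> V \<rightarrow> U \<Longrightarrow> m \<in> U \<Longrightarrow> case_option m e \<in> adjoin V \<rightarrow> U"
  by auto

locale cl_structure =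
  fixes L :: "('f, 'p) cl_lang" and M :: "('f, 'p, 'm) cl_struct"
  assumes lang: "is_lang L" and struct: "is_struct L M"
begin

text \<open>The variables of a definable predicate may come from any type \<open>'v\<close>, so that assignments can
  be indexed by the meaning of the variables: quantification removes \<open>None\<close> from an \<open>option\<close> type,
  and parameters may serve as their own names.\<close>

definition definable :: "'v set \<Rightarrow> (('v \<Rightarrow> 'm) \<Rightarrow> real) \<Rightarrow> bool" where
  "definable V F \<longleftrightarrow> (\<exists>\<phi> \<sigma>. wf_fm L \<phi> \<and> \<sigma> ` fvars \<phi> \<subseteq> V \<and> F = (\<lambda>e. feval M (e \<circ> \<sigma>) \<phi>))"

lemma definableI:
  "wf_fm L \<phi> \<Longrightarrow> \<sigma> ` fvars \<phi> \<subseteq> V \<Longrightarrow> (\<And>e. F e = feval M (e \<circ> \<sigma>) \<phi>) \<Longrightarrow> definable V F"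
  unfolding definable_def by blast

lemma definableE:
  assumes "definable V F"
  obtains \<phi> \<sigma> where "wf_fm L \<phi>" "\<sigma> ` fvars \<phi> \<subseteq> V" "F = (\<lambda>e. feval M (e \<circ> \<sigma>) \<phi>)"
  using assms unfolding definable_def by blast

lemma definable_cong:
  assumes "definable V F" "\<And>v. v \<in> V \<Longrightarrow> e v = e' v"
  shows "F e = F e'"
proof -
  obtain \<phi> \<sigma> where "\<sigma> ` fvars \<phi> \<subseteq> V" "F = (\<lambda>e. feval M (e \<circ> \<sigma>) \<phi>)"
    using assms(1) by (rule definableE)
  then show ?thesis
    using assms(2) by (auto intro!: feval_cong)
qed

lemma definable_mono: "definable V F \<Longrightarrow> V \<subseteq> W \<Longrightarrow> definable W F"
  unfolding definable_def by blast

lemma definable_finite_support: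
  assumes "definable V F"
  obtains V' where "finite V'" "V' \<subseteq> V" "definable V' F"
proof -
  obtain \<phi> \<sigma> where \<phi>: "wf_fm L \<phi>" "\<sigma> ` fvars \<phi> \<subseteq> V" "F = (\<lambda>e. feval M (e \<circ> \<sigma>) \<phi>)"
    using assms by (rule definableE)
  show ?thesis
    by (rule that[of "\<sigma> ` fvars \<phi>"]) (use \<phi> in \<open>auto simp: finite_fvars intro: definableI\<close>)
qed

lemma definable_reindex:
  assumes "definable V F" "\<tau> ` V \<subseteq> W"
  shows "definable W (\<lambda>e. F (e \<circ> \<tau>))"
proof -
  obtain \<phi> \<sigma> where "wf_fm L \<phi>" "\<sigma> ` fvars \<phi> \<subseteq> V" "F = (\<lambda>e. feval M (e \<circ> \<sigma>) \<phi>)"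
    using assms(1) by (rule definableE)
  then show ?thesis
    using assms(2) by (intro definableI[of \<phi> "\<tau> \<circ> \<sigma>"]) (auto simp: comp_assoc)
qed

lemma definable_Conn:
  assumes "connective (length Fs) u" "\<And>F. F \<in> set Fs \<Longrightarrow> definable V F"
  shows "definable V (\<lambda>e. u (map (\<lambda>F. F e) Fs))"
proof -
  obtain \<phi> \<sigma> where \<phi>: "wf_fm L (\<phi> F)" "\<sigma> F ` fvars (\<phi> F) \<subseteq> V" "F = (\<lambda>e. feval M (e \<circ> \<sigma> F) (\<phi> F))"
    if "F \<in> set Fs" for F
    using assms(2) unfolding definable_def by metis
  define \<psi> where "\<psi> k = rename (\<lambda>v. prod_encode (k, v)) (\<phi> (Fs ! k))" for k
  define \<tau> where "\<tau> w = (case prod_decode w of (k, v) \<Rightarrow> \<sigma> (Fs ! k) v)" for w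
  have \<psi>: "wf_fm L (\<psi> k)" "\<tau> ` fvars (\<psi> k) \<subseteq> V" "feval M (e \<circ> \<tau>) (\<psi> k) = (Fs ! k) e"
    if "k < length Fs" for k e
  proof -
    have nth_in_Fs: "Fs ! k \<in> set Fs"
      using that by simp
    have \<tau>: "\<tau> \<circ> (\<lambda>v. prod_encode (k, v)) = \<sigma> (Fs ! k)"
      by (auto simp: \<tau>_def)
    show "wf_fm L (\<psi> k)"
      unfolding \<psi>_def by (rule wf_rename[OF \<phi>(1)[OF nth_in_Fs]])
    show "\<tau> ` fvars (\<psi> k) \<subseteq> V"
      using image_mono[OF fvars_rename, of \<tau> "\<lambda>v. prod_encode (k, v)" "\<phi> (Fs ! k)"] \<phi>(2)[OF nth_in_Fs]
      by (simp add: \<psi>_def image_comp \<tau>)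
    show "feval M (e \<circ> \<tau>) (\<psi> k) = (Fs ! k) e"
      unfolding \<psi>_def feval_rename comp_assoc \<tau> using fun_cong[OF \<phi>(3)[OF nth_in_Fs], of e] by simp
  qed
  show ?thesis
  proof (rule definableI)
    show "wf_fm L (Conn u (map \<psi> [0..<length Fs]))"
      using assms(1) \<psi>(1) by simp
    show "\<tau> ` fvars (Conn u (map \<psi> [0..<length Fs])) \<subseteq> V"
      using \<psi>(2) by (force simp: image_subset_iff)
    have "map (\<lambda>F. F e) Fs = map (\<lambda>k. feval M (e \<circ> \<tau>) (\<psi> k)) [0..<length Fs]" for e
      by (rule nth_equalityI) (simp_all add: \<psi>(3))
    then show "u (map (\<lambda>F. F e) Fs) = feval M (e \<circ> \<tau>) (Conn u (map \<psi> [0..<length Fs]))" for e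
      by (simp add: comp_def)
  qed
qed

lemma definable_unary:
  assumes "definable V F" "continuous_on {0..1} u" "u ` {0..1} \<subseteq> {0..1}"
  shows "definable V (\<lambda>e. u (F e))"
proof -
  have "definable V (\<lambda>e. u (map (\<lambda>F. F e) [F] ! 0))"
    by (rule definable_Conn) (use assms connective_unary in simp_all)
  then show ?thesis by simp
qed

lemma definable_max:
  assumes "definable V F" "definable V G"
  shows "definable V (\<lambda>e. max (F e) (G e))"
proof -
  have "definable V (\<lambda>e. max (map (\<lambda>F. F e) [F, G] ! 0) (map (\<lambda>F. F e) [F, G] ! 1))"
    by (rule definable_Conn) (use assms connective_max in auto)
  then show ?thesis by simp
qed

lemma definable_0: "definable V (\<lambda>_. 0)"
  by (rule definable_Conn[of "[]" "\<lambda>_. 0"]) (simp_all add: connective_def)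

lemma definable_INF:
  assumes "definable (adjoin V) F"
  shows "definable V (\<lambda>e. INF m\<in>univ M. slice F e m)"
proof -
  obtain \<phi> \<sigma> where \<phi>: "wf_fm L \<phi>" "\<sigma> ` fvars \<phi> \<subseteq> adjoin V" "F = (\<lambda>e. feval M (e \<circ> \<sigma>) \<phi>)"
    using assms by (rule definableE)
  define z where "z = fresh_for (fvars \<phi>)"
  define \<tau> where "\<tau> v = (if \<sigma> v = None then z else v)" for v
  have z: "v \<noteq> z" if "v \<in> fvars \<phi>" for v
    using that fresh_for_notin[OF finite_fvars] unfolding z_def by metis
  show ?thesis
  proof (rule definableI)
    show "wf_fm L (InfQ z (rename \<tau> \<phi>))"
      using \<phi>(1) by (simp add: wf_rename)
    show "(the \<circ> \<sigma>) ` fvars (InfQ z (rename \<tau> \<phi>)) \<subseteq> V"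
    proof (rule image_subsetI)
      fix v assume "v \<in> fvars (InfQ z (rename \<tau> \<phi>))"
      then have "v \<in> fvars \<phi>" "\<sigma> v \<noteq> None"
        using fvars_rename[of \<tau> \<phi>] by (auto simp: \<tau>_def split: if_splits)
      then show "(the \<circ> \<sigma>) v \<in> V"
        using \<phi>(2) by auto
    qed
    have "slice F e m = feval M ((e \<circ> (the \<circ> \<sigma>))(z := m)) (rename \<tau> \<phi>)" for e m
      unfolding slice_def \<phi>(3) feval_rename
      by (rule feval_cong) (use z in \<open>auto simp: \<tau>_def split: option.split\<close>)
    then show "(INF m\<in>univ M. slice F e m) = feval M (e \<circ> (the \<circ> \<sigma>)) (InfQ z (rename \<tau> \<phi>))" for e
      by simp
  qed
qed

lemma definable_iff_value_at:
  "definable (set ss) F \<longleftrightarrow>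
     (\<exists>\<phi>. fm_in L (length ss) \<phi> \<and> F = (\<lambda>e. value_at M \<phi> (map e ss)))"
proof
  assume "definable (set ss) F"
  then obtain \<phi> \<sigma> where \<phi>: "wf_fm L \<phi>" "\<sigma> ` fvars \<phi> \<subseteq> set ss" "F = (\<lambda>e. feval M (e \<circ> \<sigma>) \<phi>)"
    by (rule definableE)
  have "\<forall>s\<in>set ss. \<exists>i. i < length ss \<and> ss ! i = s"
    by (simp add: in_set_conv_nth)
  then obtain pos where pos: "\<forall>s\<in>set ss. pos s < length ss \<and> ss ! pos s = s"
    by (rule bchoice[THEN exE])
  have "(pos \<circ> \<sigma>) ` fvars \<phi> \<subseteq> {..<length ss}"
    using \<phi>(2) pos by auto
  then have "fm_in L (length ss) (rename (pos \<circ> \<sigma>) \<phi>)"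
    unfolding fm_in_def using wf_rename[OF \<phi>(1)] order_trans[OF fvars_rename] by blast
  moreover have "F e = value_at M (rename (pos \<circ> \<sigma>) \<phi>) (map e ss)" for e
    unfolding value_at_def feval_rename \<phi>(3) using \<phi>(2) pos
    by (intro feval_cong) (auto simp: image_subset_iff)
  ultimately show "\<exists>\<phi>. fm_in L (length ss) \<phi> \<and> F = (\<lambda>e. value_at M \<phi> (map e ss))"
    by blast
next
  assume "\<exists>\<phi>. fm_in L (length ss) \<phi> \<and> F = (\<lambda>e. value_at M \<phi> (map e ss))"
  then obtain \<phi> where \<phi>: "wf_fm L \<phi>" "fvars \<phi> \<subseteq> {..<length ss}" "F = (\<lambda>e. value_at M \<phi> (map e ss))"
    unfolding fm_in_def by blast
  show "definable (set ss) F"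
  proof (rule definableI[OF \<phi>(1)])
    show "(!) ss ` fvars \<phi> \<subseteq> set ss"
      using \<phi>(2) by auto
    show "F e = feval M (e \<circ> (!) ss) \<phi>" for e
      unfolding \<phi>(3) value_at_def using \<phi>(2) by (intro feval_cong) auto
  qed
qed

lemma definable_pred1_slice:
  assumes "definable (adjoin V) F" "e \<in> V \<rightarrow> univ M"
  shows "definable_pred1 L M (slice F e)"
proof -
  obtain W where W: "finite W" "W \<subseteq> adjoin V" "definable W F"
    using assms(1) by (rule definable_finite_support)
  obtain vs where vs: "set vs = Some -` W"
    using finite_list[OF finite_vimageI[OF W(1) inj_Some]] by auto
  have "w \<in> set (None # map Some vs)" if "w \<in> W" for w
    using that by (cases w) (auto simp: vs)
  then have "W \<subseteq> set (None # map Some vs)"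
    by (rule subsetI)
  from definable_mono[OF W(3) this]
  obtain \<phi> where \<phi>: "fm_in L (Suc (length vs)) \<phi>"
    "F = (\<lambda>e. value_at M \<phi> (e None # map (e \<circ> Some) vs))"
    unfolding definable_iff_value_at by auto
  have "slice F e = (\<lambda>x. value_at M \<phi> (x # map e vs))"
    unfolding slice_def \<phi>(2) by (simp add: comp_def)
  moreover have "set (map e vs) \<subseteq> univ M"
    using vs W(2) assms(2) by auto
  ultimately show ?thesis
    unfolding definable_pred1_def using \<phi>(1)
    by (intro exI[of _ "\<lambda>_. \<phi>"] exI[of _ "\<lambda>_. map e vs"]) (auto simp: uniform_limit_const)
qed

end

section \<open>Uniform continuity of definable predicates\<close>

lemma compact_unit_cube: "compact {x :: nat \<Rightarrow> real. range x \<subseteq> {0..1}}"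
proof -
  have "compactin (product_topology (\<lambda>_. euclidean) UNIV) (PiE UNIV (\<lambda>_::nat. {0..1::real}))"
    by (simp add: compactin_PiE)
  moreover have "PiE UNIV (\<lambda>_::nat. {0..1::real}) = {x. range x \<subseteq> {0..1}}"
    by (fastforce simp: PiE_def)
  ultimately show ?thesis
    by (simp add: euclidean_product_topology)
qed

lemma dist_fun_le:
  fixes x y :: "'a::countable \<Rightarrow> 'b::metric_space"
  assumes "\<And>n. dist (x n) (y n) \<le> \<delta>"
  shows "dist x y \<le> 2 * \<delta>"
proof (rule LIMSEQ_le_const)
  show "(\<lambda>N. 2 * \<delta> + (1/2) ^ N) \<longlonglongrightarrow> 2 * \<delta>"
    by (auto intro!: tendsto_eq_intros LIMSEQ_power_zero)
  have "dist x y \<le> 2 * \<delta> + (1/2) ^ N" for N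
  proof -
    have "Max {dist (x (from_nat n)) (y (from_nat n)) |n. n \<le> N} \<le> \<delta>"
      using assms by (intro Max.boundedI) auto
    then show ?thesis
      using dist_fun_le_dist_first_terms[of x y N] by simp
  qed
  then show "\<exists>N. \<forall>n\<ge>N. dist x y \<le> 2 * \<delta> + (1/2) ^ n"
    by blast
qed

lemma connective_uniformly_continuous:
  assumes "connective n u" and "\<epsilon> > 0"
  obtains \<delta> where "\<delta> > 0"
    "\<And>xs ys. length xs = n \<Longrightarrow> length ys = n \<Longrightarrow> set xs \<subseteq> {0..1} \<Longrightarrow> set ys \<subseteq> {0..1} \<Longrightarrow>
       (\<And>i. i < n \<Longrightarrow> \<bar>xs ! i - ys ! i\<bar> \<le> \<delta>) \<Longrightarrow> \<bar>u xs - u ys\<bar> \<le> \<epsilon>"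
proof -
  let ?Q = "{x :: nat \<Rightarrow> real. range x \<subseteq> {0..1}}"
  have "uniformly_continuous_on ?Q (\<lambda>x. u (map x [0..<n]))"
    using assms(1) unfolding connective_def
    by (intro compact_uniformly_continuous compact_unit_cube) auto
  then obtain d where d: "d > 0"
      "\<And>x y. x \<in> ?Q \<Longrightarrow> y \<in> ?Q \<Longrightarrow> dist y x < d \<Longrightarrow>
         dist (u (map y [0..<n])) (u (map x [0..<n])) < \<epsilon>"
    using assms(2) unfolding uniformly_continuous_on_def by metis
  define ext :: "real list \<Rightarrow> nat \<Rightarrow> real" where "ext zs = (\<lambda>i. if i < n then zs ! i else 0)" for zs
  have map_ext: "map (ext zs) [0..<n] = zs" if "length zs = n" for zs
    using that by (intro nth_equalityI) (auto simp: ext_def)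
  have ext_in_cube: "ext zs \<in> ?Q" if "length zs = n" "set zs \<subseteq> {0..1}" for zs
    using that by (fastforce simp: ext_def subset_iff)
  show ?thesis
  proof (rule that[of "d/4"])
    fix xs ys :: "real list"
    assume xs: "length xs = n" "set xs \<subseteq> {0..1}" and ys: "length ys = n" "set ys \<subseteq> {0..1}"
      and close: "\<And>i. i < n \<Longrightarrow> \<bar>xs ! i - ys ! i\<bar> \<le> d/4"
    have "dist (ext xs) (ext ys) \<le> 2 * (d/4)"
      using close d(1) by (intro dist_fun_le) (auto simp: ext_def dist_real_def)
    then have "dist (u (map (ext xs) [0..<n])) (u (map (ext ys) [0..<n])) < \<epsilon>"
      using d xs ys by (intro d(2) ext_in_cube) auto
    then show "\<bar>u xs - u ys\<bar> \<le> \<epsilon>"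
      using xs ys by (simp add: map_ext dist_real_def)
  qed (use d in simp)
qed

lemma abs_SUP_diff_le:
  fixes f g :: "'a \<Rightarrow> real"
  assumes "S \<noteq> {}" "bdd_above (f ` S)" "bdd_above (g ` S)" and "\<And>x. x \<in> S \<Longrightarrow> \<bar>f x - g x\<bar> \<le> \<epsilon>"
  shows "\<bar>(SUP x\<in>S. f x) - (SUP x\<in>S. g x)\<bar> \<le> \<epsilon>"
proof -
  have le: "(SUP x\<in>S. h x) \<le> (SUP x\<in>S. k x) + \<epsilon>"
    if "bdd_above (k ` S)" "\<And>x. x \<in> S \<Longrightarrow> h x \<le> k x + \<epsilon>" for h k :: "'a \<Rightarrow> real"
    using assms(1)
  proof (rule cSUP_least)
    fix x assume "x \<in> S"
    then show "h x \<le> (SUP x\<in>S. k x) + \<epsilon>"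
      using that(2) cSUP_upper[OF _ that(1)] by (meson add_right_mono order_trans)
  qed
  have "f x \<le> g x + \<epsilon>" "g x \<le> f x + \<epsilon>" if "x \<in> S" for x
    using assms(4)[OF that] by linarith+
  then show ?thesis
    using le[of g f, OF assms(3)] le[of f g, OF assms(2)] by fastforce
qed

lemma abs_INF_diff_le:
  fixes f g :: "'a \<Rightarrow> real"
  assumes "S \<noteq> {}" "bdd_below (f ` S)" "bdd_below (g ` S)" and "\<And>x. x \<in> S \<Longrightarrow> \<bar>f x - g x\<bar> \<le> \<epsilon>"
  shows "\<bar>(INF x\<in>S. f x) - (INF x\<in>S. g x)\<bar> \<le> \<epsilon>"
proof -
  have "bdd_above ((\<lambda>x. - f x) ` S)" "bdd_above ((\<lambda>x. - g x) ` S)"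
    using assms(2,3) bdd_above_uminus[of "f ` S"] bdd_above_uminus[of "g ` S"]
    by (simp_all add: image_image)
  then have "\<bar>(SUP x\<in>S. - f x) - (SUP x\<in>S. - g x)\<bar> \<le> \<epsilon>"
    using assms(1,4) by (intro abs_SUP_diff_le) (auto simp: abs_minus_commute)
  then show ?thesis
    by (simp add: Inf_real_def image_image abs_minus_commute)
qed

context cl_structure
begin

lemma univ_nonempty: "univ M \<noteq> {}"
  using struct unfolding is_struct_def by (rule conjunct1)

lemma mdist_self: "x \<in> univ M \<Longrightarrow> mdist (met M) x x = 0"
  by (rule Metric_space.mdist_zero[OF Metric_space_mspace_mdist])

lemma mdist_le_1: "x \<in> univ M \<Longrightarrow> y \<in> univ M \<Longrightarrow> mdist (met M) x y \<le> 1"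
  using struct unfolding is_struct_def by blast

lemma fint_in_univ: "f \<in> Funs L \<Longrightarrow> xs \<in> tuples M (farity L f) \<Longrightarrow> fint M f xs \<in> univ M"
  using struct unfolding is_struct_def by blast

lemma fint_modulus:
  "f \<in> Funs L \<Longrightarrow> \<epsilon> > 0 \<Longrightarrow> xs \<in> tuples M (farity L f) \<Longrightarrow> ys \<in> tuples M (farity L f) \<Longrightarrow>
   close_tuples M (fmodulus L f \<epsilon>) xs ys \<Longrightarrow> mdist (met M) (fint M f xs) (fint M f ys) \<le> \<epsilon>"
  using struct[unfolded is_struct_def, THEN conjunct2, THEN conjunct2, THEN conjunct2, THEN conjunct1]
  by simp

lemma pint_in_unit: "p \<in> Preds L \<Longrightarrow> xs \<in> tuples M (parity L p) \<Longrightarrow> pint M p xs \<in> {0..1}"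
  using struct unfolding is_struct_def by blast

lemma pint_modulus:
  "p \<in> Preds L \<Longrightarrow> \<epsilon> > 0 \<Longrightarrow> xs \<in> tuples M (parity L p) \<Longrightarrow> ys \<in> tuples M (parity L p) \<Longrightarrow>
   close_tuples M (pmodulus L p \<epsilon>) xs ys \<Longrightarrow> \<bar>pint M p xs - pint M p ys\<bar> \<le> \<epsilon>"
  using struct[unfolded is_struct_def, THEN conjunct2, THEN conjunct2, THEN conjunct2, THEN conjunct2]
  by simp

lemma teval_in_univ: "wf_term L t \<Longrightarrow> e \<in> tvars t \<rightarrow> univ M \<Longrightarrow> teval M e t \<in> univ M"
proof (induction t)
  case (Fn f ts)
  then have "map (teval M e) ts \<in> tuples M (farity L f)"
    by (fastforce simp: tuples_def)
  then show ?case
    using Fn.prems(1) by (simp add: fint_in_univ)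
qed auto

lemma map_teval_in_tuples:
  assumes "\<forall>t\<in>set ts. wf_term L t" "(\<Union>t\<in>set ts. tvars t) \<subseteq> V" "e \<in> V \<rightarrow> univ M"
  shows "map (teval M e) ts \<in> tuples M (length ts)"
proof -
  have "teval M e t \<in> univ M" if "t \<in> set ts" for t
    using assms that by (intro teval_in_univ) auto
  then show ?thesis
    by (auto simp: tuples_def)
qed

lemma feval_in_unit: "wf_fm L \<phi> \<Longrightarrow> e \<in> fvars \<phi> \<rightarrow> univ M \<Longrightarrow> feval M e \<phi> \<in> {0..1}"
proof (induction \<phi> arbitrary: e)
  case (Pred p ts)
  then have "map (teval M e) ts \<in> tuples M (parity L p)"
    using map_teval_in_tuples[OF _ order_refl, of ts e] by simp
  then show ?case
    using Pred.prems(1) pint_in_unit by simp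
next
  case (Dist s t)
  then have "teval M e s \<in> univ M" "teval M e t \<in> univ M"
    by (auto intro!: teval_in_univ)
  then show ?case
    by (simp add: mdist_le_1 Metric_space.nonneg[OF Metric_space_mspace_mdist])
next
  case (Conn u \<phi>s)
  have "feval M e \<phi> \<in> {0..1}" if "\<phi> \<in> set \<phi>s" for \<phi>
    using Conn.prems that by (intro Conn.IH) auto
  then have "set (map (feval M e) \<phi>s) \<subseteq> {0..1}"
    by (auto simp only: set_map)
  then show ?case
    using Conn.prems(1) unfolding wf_fm.simps feval.simps connective_def by simp
next
  case (SupQ x \<phi>)
  then have "(\<lambda>m. feval M (e(x := m)) \<phi>) ` univ M \<subseteq> {0..1}"
    by (intro image_subsetI SupQ.IH) (auto simp: Pi_iff)
  then show ?case
    unfolding feval.simps using univ_nonempty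
    by (intro closed_subset_contains_Sup bdd_above_mono[OF bdd_above_Icc]) simp_all
next
  case (InfQ x \<phi>)
  then have "(\<lambda>m. feval M (e(x := m)) \<phi>) ` univ M \<subseteq> {0..1}"
    by (intro image_subsetI InfQ.IH) (auto simp: Pi_iff)
  then show ?case
    unfolding feval.simps using univ_nonempty
    by (intro closed_subset_contains_Inf bdd_below_mono[OF bdd_below_Icc]) simp_all
qed

lemma bdd_feval_upd:
  assumes "wf_fm L \<phi>" "fvars \<phi> - {x} \<subseteq> V" "e \<in> V \<rightarrow> univ M"
  shows "bdd_above ((\<lambda>m. feval M (e(x := m)) \<phi>) ` univ M)"
    and "bdd_below ((\<lambda>m. feval M (e(x := m)) \<phi>) ` univ M)"
proof -
  have "(\<lambda>m. feval M (e(x := m)) \<phi>) ` univ M \<subseteq> {0..1}"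
    using assms by (intro image_subsetI feval_in_unit) (auto simp: Pi_iff)
  then show "bdd_above ((\<lambda>m. feval M (e(x := m)) \<phi>) ` univ M)"
    "bdd_below ((\<lambda>m. feval M (e(x := m)) \<phi>) ` univ M)"
    by (rule bdd_above_mono[OF bdd_above_Icc], rule bdd_below_mono[OF bdd_below_Icc])
qed

lemma definable_in_unit: "definable V F \<Longrightarrow> e \<in> V \<rightarrow> univ M \<Longrightarrow> F e \<in> {0..1}"
  unfolding definable_def
  by (auto simp: image_subset_iff Pi_iff simp del: atLeastAtMost_iff intro!: feval_in_unit)

definition close_on :: "nat set \<Rightarrow> real \<Rightarrow> ((nat \<Rightarrow> 'm) \<times> (nat \<Rightarrow> 'm)) set" where
  "close_on V \<delta> = {(e, e').
     e \<in> V \<rightarrow> univ M \<and> e' \<in> V \<rightarrow> univ M \<and> (\<forall>v\<in>V. mdist (met M) (e v) (e' v) < \<delta>)}"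

definition nearby :: "nat set \<Rightarrow> ((nat \<Rightarrow> 'm) \<times> (nat \<Rightarrow> 'm)) filter" where
  "nearby V = (INF \<delta>\<in>{0<..}. principal (close_on V \<delta>))"

lemma eventually_nearby:
  "(\<forall>\<^sub>F (e, e') in nearby V. P e e') \<longleftrightarrow>
     (\<exists>\<delta>>0. \<forall>e\<in>V \<rightarrow> univ M. \<forall>e'\<in>V \<rightarrow> univ M.
        (\<forall>v\<in>V. mdist (met M) (e v) (e' v) < \<delta>) \<longrightarrow> P e e')"
  unfolding nearby_def
proof (subst eventually_INF_base)
  fix \<delta> \<delta>' :: real
  assume "\<delta> \<in> {0<..}" "\<delta>' \<in> {0<..}"
  then show "\<exists>\<delta>''\<in>{0<..}.
      principal (close_on V \<delta>'') \<le> inf (principal (close_on V \<delta>)) (principal (close_on V \<delta>'))"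
    by (intro bexI[of _ "min \<delta> \<delta>'"]) (auto simp: close_on_def)
qed (force simp: eventually_principal close_on_def)+

lemma eventually_nearby_in_univ: "\<forall>\<^sub>F (e, e') in nearby V. e \<in> V \<rightarrow> univ M \<and> e' \<in> V \<rightarrow> univ M"
  unfolding eventually_nearby by (intro exI[of _ 1]) auto

lemma eventually_nearby_upd:
  assumes "\<forall>\<^sub>F (e, e') in nearby (insert x V). P e e'"
  shows "\<forall>\<^sub>F (e, e') in nearby V. \<forall>m\<in>univ M. P (e(x := m)) (e'(x := m))"
proof -
  obtain \<delta> where "\<delta> > 0" and \<delta>: "\<And>e e'. e \<in> insert x V \<rightarrow> univ M \<Longrightarrow> e' \<in> insert x V \<rightarrow> univ M \<Longrightarrow>
      (\<forall>v\<in>insert x V. mdist (met M) (e v) (e' v) < \<delta>) \<Longrightarrow> P e e'"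
    using assms unfolding eventually_nearby by metis
  have "P (e(x := m)) (e'(x := m))"
    if "e \<in> V \<rightarrow> univ M" "e' \<in> V \<rightarrow> univ M" "\<forall>v\<in>V. mdist (met M) (e v) (e' v) < \<delta>" "m \<in> univ M"
    for e e' m
    using that \<open>\<delta> > 0\<close> by (intro \<delta>) (auto simp: mdist_self)
  then show ?thesis
    unfolding eventually_nearby using \<open>\<delta> > 0\<close> by blast
qed

lemma eventually_nearby_ball:
  "(\<And>t. t \<in> set ts \<Longrightarrow> \<forall>\<^sub>F (e, e') in nearby V. P t e e') \<Longrightarrow>
   \<forall>\<^sub>F (e, e') in nearby V. \<forall>t\<in>set ts. P t e e'"
  by (simp add: case_prod_unfold eventually_ball_finite)

lemma close_tuples_map:
  "(\<And>t. t \<in> set ts \<Longrightarrow> mdist (met M) (f t) (g t) < \<delta>) \<Longrightarrow> close_tuples M \<delta> (map f ts) (map g ts)"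
  unfolding close_tuples_def by (induction ts) auto

lemma teval_uniformly_continuous:
  assumes "wf_term L t" "tvars t \<subseteq> V" "\<epsilon> > 0"
  shows "\<forall>\<^sub>F (e, e') in nearby V. mdist (met M) (teval M e t) (teval M e' t) < \<epsilon>"
  using assms
proof (induction t arbitrary: \<epsilon>)
  case (Var x)
  then show ?case
    unfolding eventually_nearby by (intro exI[of _ \<epsilon>]) auto
next
  case (Fn f ts)
  have "fmodulus L f (\<epsilon>/2) > 0"
    using lang Fn.prems unfolding is_lang_def by auto
  then have "\<forall>\<^sub>F (e, e') in nearby V. \<forall>t\<in>set ts.
      mdist (met M) (teval M e t) (teval M e' t) < fmodulus L f (\<epsilon>/2)"
    using Fn.prems by (intro eventually_nearby_ball Fn.IH) auto
  with eventually_nearby_in_univ show ?case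
  proof eventually_elim
    case (elim p)
    obtain e e' where p: "p = (e, e')" by (cases p)
    have "map (teval M e) ts \<in> tuples M (farity L f)" "map (teval M e') ts \<in> tuples M (farity L f)"
      using elim Fn.prems(1,2) map_teval_in_tuples[of ts V] by (simp_all add: p)
    moreover have "close_tuples M (fmodulus L f (\<epsilon>/2)) (map (teval M e) ts) (map (teval M e') ts)"
      using elim by (intro close_tuples_map) (simp add: p)
    ultimately have
      "mdist (met M) (fint M f (map (teval M e) ts)) (fint M f (map (teval M e') ts)) \<le> \<epsilon>/2"
      using Fn.prems by (intro fint_modulus) simp_all
    then show ?case
      using Fn.prems by (simp add: p)
  qed
qed

lemma Pred_uniformly_continuous:
  assumes "wf_fm L (Pred p ts)" "fvars (Pred p ts) \<subseteq> V" "\<epsilon> > 0"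
  shows "\<forall>\<^sub>F (e, e') in nearby V. \<bar>feval M e (Pred p ts) - feval M e' (Pred p ts)\<bar> \<le> \<epsilon>"
proof -
  have "pmodulus L p \<epsilon> > 0"
    using lang assms unfolding is_lang_def by auto
  then have "\<forall>\<^sub>F (e, e') in nearby V. \<forall>t\<in>set ts.
      mdist (met M) (teval M e t) (teval M e' t) < pmodulus L p \<epsilon>"
    using assms by (intro eventually_nearby_ball teval_uniformly_continuous) auto
  with eventually_nearby_in_univ show ?thesis
  proof eventually_elim
    case (elim q)
    obtain e e' where q: "q = (e, e')" by (cases q)
    have "map (teval M e) ts \<in> tuples M (parity L p)" "map (teval M e') ts \<in> tuples M (parity L p)"
      using elim assms(1,2) map_teval_in_tuples[of ts V] by (simp_all add: q)
    moreover have "close_tuples M (pmodulus L p \<epsilon>) (map (teval M e) ts) (map (teval M e') ts)"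
      using elim by (intro close_tuples_map) (simp add: q)
    ultimately have "\<bar>pint M p (map (teval M e) ts) - pint M p (map (teval M e') ts)\<bar> \<le> \<epsilon>"
      using assms by (intro pint_modulus) simp_all
    then show ?case by (simp add: q)
  qed
qed

lemma Dist_uniformly_continuous:
  assumes "wf_fm L (Dist s t)" "fvars (Dist s t) \<subseteq> V" "\<epsilon> > 0"
  shows "\<forall>\<^sub>F (e, e') in nearby V. \<bar>feval M e (Dist s t) - feval M e' (Dist s t)\<bar> \<le> \<epsilon>"
proof -
  interpret Metric_space "univ M" "mdist (met M)"
    by (rule Metric_space_mspace_mdist)
  have "\<forall>\<^sub>F (e, e') in nearby V. mdist (met M) (teval M e s) (teval M e' s) < \<epsilon>/2"
    "\<forall>\<^sub>F (e, e') in nearby V. mdist (met M) (teval M e t) (teval M e' t) < \<epsilon>/2"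
    using assms by (intro teval_uniformly_continuous; simp)+
  with eventually_nearby_in_univ show ?thesis
  proof eventually_elim
    case (elim p)
    obtain e e' where p: "p = (e, e')" by (cases p)
    have "teval M e s \<in> univ M" "teval M e' s \<in> univ M"
      "teval M e t \<in> univ M" "teval M e' t \<in> univ M"
      using elim assms by (auto simp: p intro!: teval_in_univ)
    then have
      "\<bar>mdist (met M) (teval M e s) (teval M e t) - mdist (met M) (teval M e' s) (teval M e' t)\<bar> \<le>
        mdist (met M) (teval M e s) (teval M e' s) + mdist (met M) (teval M e t) (teval M e' t)"
      using triangle commute by (smt (verit))
    then show ?case
      using elim by (simp add: p)
  qed
qed

lemma Conn_uniformly_continuous:
  assumes wf: "wf_fm L (Conn u \<phi>s)" and fvars: "fvars (Conn u \<phi>s) \<subseteq> V" and "\<epsilon> > 0"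
    and unif: "\<And>\<phi> \<epsilon>. \<phi> \<in> set \<phi>s \<Longrightarrow> \<epsilon> > 0 \<Longrightarrow> \<forall>\<^sub>F (e, e') in nearby V. \<bar>feval M e \<phi> - feval M e' \<phi>\<bar> \<le> \<epsilon>"
  shows "\<forall>\<^sub>F (e, e') in nearby V. \<bar>feval M e (Conn u \<phi>s) - feval M e' (Conn u \<phi>s)\<bar> \<le> \<epsilon>"
proof -
  have connective: "connective (length \<phi>s) u"
    using wf by simp
  obtain d where "d > 0" and d: "\<And>xs ys. length xs = length \<phi>s \<Longrightarrow> length ys = length \<phi>s \<Longrightarrow>
      set xs \<subseteq> {0..1} \<Longrightarrow> set ys \<subseteq> {0..1} \<Longrightarrow>
      (\<And>i. i < length \<phi>s \<Longrightarrow> \<bar>xs ! i - ys ! i\<bar> \<le> d) \<Longrightarrow> \<bar>u xs - u ys\<bar> \<le> \<epsilon>"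
    using connective_uniformly_continuous[OF connective \<open>\<epsilon> > 0\<close>] by blast
  have "\<forall>\<^sub>F (e, e') in nearby V. \<forall>\<phi>\<in>set \<phi>s. \<bar>feval M e \<phi> - feval M e' \<phi>\<bar> \<le> d"
    using \<open>d > 0\<close> by (intro eventually_nearby_ball unif)
  with eventually_nearby_in_univ show ?thesis
  proof eventually_elim
    case (elim p)
    obtain e e' where p: "p = (e, e')" by (cases p)
    have "feval M e \<phi> \<in> {0..1}" "feval M e' \<phi> \<in> {0..1}" if "\<phi> \<in> set \<phi>s" for \<phi>
      using elim wf fvars that by (auto simp: p simp del: atLeastAtMost_iff intro!: feval_in_unit)
    then have "\<bar>u (map (feval M e) \<phi>s) - u (map (feval M e') \<phi>s)\<bar> \<le> \<epsilon>"
      using elim by (intro d) (simp_all only: p set_map image_subset_iff, simp_all)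
    then show ?case by (simp add: p)
  qed
qed

lemma feval_uniformly_continuous:
  assumes "wf_fm L \<phi>" "fvars \<phi> \<subseteq> V" "\<epsilon> > 0"
  shows "\<forall>\<^sub>F (e, e') in nearby V. \<bar>feval M e \<phi> - feval M e' \<phi>\<bar> \<le> \<epsilon>"
  using assms
proof (induction \<phi> arbitrary: V \<epsilon>)
  case (Pred p ts)
  then show ?case by (rule Pred_uniformly_continuous)
next
  case (Dist s t)
  then show ?case by (rule Dist_uniformly_continuous)
next
  case (Conn u \<phi>s)
  then show ?case by (intro Conn_uniformly_continuous Conn.IH) auto
next
  case (SupQ x \<phi>)
  then have "\<forall>\<^sub>F (e, e') in nearby (insert x V). \<bar>feval M e \<phi> - feval M e' \<phi>\<bar> \<le> \<epsilon>"
    by (intro SupQ.IH) auto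
  from eventually_nearby_upd[OF this] eventually_nearby_in_univ show ?case
  proof eventually_elim
    case (elim p)
    then show ?case
      using SupQ.prems bdd_feval_upd(1)[of \<phi> x V]
      by (auto intro!: abs_SUP_diff_le univ_nonempty)
  qed
next
  case (InfQ x \<phi>)
  then have "\<forall>\<^sub>F (e, e') in nearby (insert x V). \<bar>feval M e \<phi> - feval M e' \<phi>\<bar> \<le> \<epsilon>"
    by (intro InfQ.IH) auto
  from eventually_nearby_upd[OF this] eventually_nearby_in_univ show ?case
  proof eventually_elim
    case (elim p)
    then show ?case
      using InfQ.prems bdd_feval_upd(2)[of \<phi> x V]
      by (auto intro!: abs_INF_diff_le univ_nonempty)
  qed
qed

lemma slice_uniformly_continuous:
  assumes "definable (adjoin V) F" "\<epsilon> > 0"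
  obtains \<delta> where "\<delta> > 0" "\<And>e x y. e \<in> V \<rightarrow> univ M \<Longrightarrow> x \<in> univ M \<Longrightarrow> y \<in> univ M \<Longrightarrow>
    mdist (met M) x y < \<delta> \<Longrightarrow> \<bar>slice F e x - slice F e y\<bar> \<le> \<epsilon>"
proof -
  obtain \<phi> \<sigma> where \<phi>: "wf_fm L \<phi>" "\<sigma> ` fvars \<phi> \<subseteq> adjoin V" "F = (\<lambda>e. feval M (e \<circ> \<sigma>) \<phi>)"
    using assms(1) by (rule definableE)
  obtain \<delta> where "\<delta> > 0" and \<delta>: "\<And>e e'. e \<in> fvars \<phi> \<rightarrow> univ M \<Longrightarrow> e' \<in> fvars \<phi> \<rightarrow> univ M \<Longrightarrow>
      (\<forall>v\<in>fvars \<phi>. mdist (met M) (e v) (e' v) < \<delta>) \<Longrightarrow> \<bar>feval M e \<phi> - feval M e' \<phi>\<bar> \<le> \<epsilon>"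
    using feval_uniformly_continuous[OF \<phi>(1) order_refl assms(2)] unfolding eventually_nearby by metis
  show ?thesis
  proof (rule that[OF \<open>\<delta> > 0\<close>])
    fix e x y assume close: "e \<in> V \<rightarrow> univ M" "x \<in> univ M" "y \<in> univ M" "mdist (met M) x y < \<delta>"
    have "(case_option x e \<circ> \<sigma>) v \<in> univ M \<and> (case_option y e \<circ> \<sigma>) v \<in> univ M \<and>
        mdist (met M) ((case_option x e \<circ> \<sigma>) v) ((case_option y e \<circ> \<sigma>) v) < \<delta>"
      if "v \<in> fvars \<phi>" for v
    proof -
      have "\<sigma> v \<in> adjoin V"
        using \<phi>(2) that by blast
      then show ?thesis
        using close \<open>\<delta> > 0\<close> by (auto simp: Pi_iff mdist_self)
    qed
    then show "\<bar>slice F e x - slice F e y\<bar> \<le> \<epsilon>"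
      unfolding slice_def \<phi>(3) by (intro \<delta>) blast+
  qed
qed

end

section \<open>Separation by definable predicates\<close>

context cl_structure
begin

text \<open>Continuous logic cannot express properties of assignments exactly.  Instead a property is
  approximated by a weaker one and a definable predicate that is \<open>0\<close> on the former and \<open>1\<close> off the
  latter; this calculus is closed under all first-order operations, including negation.\<close>

definition separated :: "'v set \<Rightarrow> (('v \<Rightarrow> 'm) \<Rightarrow> bool) \<Rightarrow> (('v \<Rightarrow> 'm) \<Rightarrow> bool) \<Rightarrow> bool" where
  "separated V P Q \<longleftrightarrow>
     (\<exists>F. definable V F \<and> (\<forall>e\<in>V \<rightarrow> univ M. (P e \<longrightarrow> F e = 0) \<and> (\<not> Q e \<longrightarrow> F e = 1)))"

lemma separatedI:
  assumes "definable V F"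
    and "\<And>e. e \<in> V \<rightarrow> univ M \<Longrightarrow> P e \<Longrightarrow> F e = 0" "\<And>e. e \<in> V \<rightarrow> univ M \<Longrightarrow> \<not> Q e \<Longrightarrow> F e = 1"
  shows "separated V P Q"
  unfolding separated_def using assms by blast

lemma separatedE:
  assumes "separated V P Q"
  obtains F where "definable V F" "\<And>e. e \<in> V \<rightarrow> univ M \<Longrightarrow> P e \<Longrightarrow> F e = 0"
    "\<And>e. e \<in> V \<rightarrow> univ M \<Longrightarrow> \<not> Q e \<Longrightarrow> F e = 1"
  using assms unfolding separated_def by blast

lemma separated_transfer:
  assumes "separated V P Q" "e \<in> V \<rightarrow> univ M" "e' \<in> V \<rightarrow> univ M" "P e"
    and "\<And>F. definable V F \<Longrightarrow> F e = F e'"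
  shows "Q e'"
proof (rule ccontr)
  assume "\<not> Q e'"
  obtain F where "definable V F" "F e = 0" "F e' = 1"
    using assms(1) by (rule separatedE) (use assms(2-4) \<open>\<not> Q e'\<close> in blast)
  then show False
    using assms(5)[of F] by simp
qed

lemma separated_mono:
  assumes "separated V P Q" "V \<subseteq> W"
    and "\<And>e. e \<in> W \<rightarrow> univ M \<Longrightarrow> P' e \<Longrightarrow> P e" "\<And>e. e \<in> W \<rightarrow> univ M \<Longrightarrow> Q e \<Longrightarrow> Q' e"
  shows "separated W P' Q'"
proof -
  obtain F where F: "definable V F" "\<And>e. e \<in> V \<rightarrow> univ M \<Longrightarrow> P e \<Longrightarrow> F e = 0"
    "\<And>e. e \<in> V \<rightarrow> univ M \<Longrightarrow> \<not> Q e \<Longrightarrow> F e = 1"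
    using assms(1) by (rule separatedE) blast
  have "W \<rightarrow> univ M \<subseteq> V \<rightarrow> univ M"
    using assms(2) by auto
  with F assms(3,4) show ?thesis
    by (intro separatedI[OF definable_mono[OF F(1) assms(2)]]) blast+
qed

lemma separated_reindex:
  assumes "separated V P Q" "\<tau> ` V \<subseteq> W"
  shows "separated W (\<lambda>e. P (e \<circ> \<tau>)) (\<lambda>e. Q (e \<circ> \<tau>))"
proof -
  obtain F where F: "definable V F" "\<And>e. e \<in> V \<rightarrow> univ M \<Longrightarrow> P e \<Longrightarrow> F e = 0"
    "\<And>e. e \<in> V \<rightarrow> univ M \<Longrightarrow> \<not> Q e \<Longrightarrow> F e = 1"
    using assms(1) by (rule separatedE) blast
  have "e \<circ> \<tau> \<in> V \<rightarrow> univ M" if "e \<in> W \<rightarrow> univ M" for e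
    using that assms(2) by (auto simp: image_subset_iff)
  with F show ?thesis
    by (intro separatedI[OF definable_reindex[OF F(1) assms(2)]]) blast+
qed

lemma separated_True: "separated V (\<lambda>_. True) (\<lambda>_. True)"
  by (rule separatedI[OF definable_0]) simp_all

lemma separated_not:
  assumes "separated V P Q"
  shows "separated V (\<lambda>e. \<not> Q e) (\<lambda>e. \<not> P e)"
proof -
  obtain F where F: "definable V F" "\<And>e. e \<in> V \<rightarrow> univ M \<Longrightarrow> P e \<Longrightarrow> F e = 0"
    "\<And>e. e \<in> V \<rightarrow> univ M \<Longrightarrow> \<not> Q e \<Longrightarrow> F e = 1"
    using assms by (rule separatedE) blast
  have "definable V (\<lambda>e. 1 - F e)"
    using F(1) by (rule definable_unary) (auto intro!: continuous_intros)
  then show ?thesis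
    by (rule separatedI) (use F in auto)
qed

lemma separated_conj:
  assumes "separated V P Q" "separated V P' Q'"
  shows "separated V (\<lambda>e. P e \<and> P' e) (\<lambda>e. Q e \<and> Q' e)"
proof -
  obtain F where F: "definable V F" "\<And>e. e \<in> V \<rightarrow> univ M \<Longrightarrow> P e \<Longrightarrow> F e = 0"
    "\<And>e. e \<in> V \<rightarrow> univ M \<Longrightarrow> \<not> Q e \<Longrightarrow> F e = 1"
    using assms(1) by (rule separatedE) blast
  obtain G where G: "definable V G" "\<And>e. e \<in> V \<rightarrow> univ M \<Longrightarrow> P' e \<Longrightarrow> G e = 0"
    "\<And>e. e \<in> V \<rightarrow> univ M \<Longrightarrow> \<not> Q' e \<Longrightarrow> G e = 1"
    using assms(2) by (rule separatedE) blast
  show ?thesis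
  proof (rule separatedI[OF definable_max[OF F(1) G(1)]])
    fix e assume e: "e \<in> V \<rightarrow> univ M"
    show "max (F e) (G e) = 0" if "P e \<and> P' e"
      using that e F(2) G(2) by simp
    have "F e \<le> 1" "G e \<le> 1"
      using definable_in_unit[OF F(1) e] definable_in_unit[OF G(1) e] by simp_all
    then show "max (F e) (G e) = 1" if "\<not> (Q e \<and> Q' e)"
      using that F(3)[OF e] G(3)[OF e] by auto
  qed
qed

lemma separated_ex:
  assumes "separated (adjoin V) (\<lambda>e. P (e \<circ> Some) (e None)) (\<lambda>e. Q (e \<circ> Some) (e None))"
  shows "separated V (\<lambda>e. \<exists>x\<in>univ M. P e x) (\<lambda>e. \<exists>x\<in>univ M. Q e x)"
proof -
  obtain F where F: "definable (adjoin V) F"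
    "\<And>e. e \<in> adjoin V \<rightarrow> univ M \<Longrightarrow> P (e \<circ> Some) (e None) \<Longrightarrow> F e = 0"
    "\<And>e. e \<in> adjoin V \<rightarrow> univ M \<Longrightarrow> \<not> Q (e \<circ> Some) (e None) \<Longrightarrow> F e = 1"
    using assms by (rule separatedE) blast
  have slice: "0 \<le> slice F e x" "P e x \<Longrightarrow> slice F e x = 0" "\<not> Q e x \<Longrightarrow> slice F e x = 1"
    if "e \<in> V \<rightarrow> univ M" "x \<in> univ M" for e x
    using definable_in_unit[OF F(1) case_option_in_Pi[OF that]] F(2,3)[OF case_option_in_Pi[OF that]]
    by (simp_all add: slice_def comp_def)
  show ?thesis
  proof (rule separatedI[OF definable_INF[OF F(1)]])
    fix e assume e: "e \<in> V \<rightarrow> univ M"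
    show "(INF x\<in>univ M. slice F e x) = 0" if "\<exists>x\<in>univ M. P e x"
    proof (rule cInf_eq_minimum)
      show "0 \<in> slice F e ` univ M"
        using that slice(2)[OF e] by force
    qed (use slice(1)[OF e] in auto)
    show "(INF x\<in>univ M. slice F e x) = 1" if "\<not> (\<exists>x\<in>univ M. Q e x)"
      using that slice(3)[OF e] univ_nonempty by simp
  qed
qed

lemma separated_ge:
  fixes u :: "real \<Rightarrow> real"
  assumes "definable V F" "continuous_on {0..1} u" "\<delta>' < \<delta>"
  shows "separated V (\<lambda>e. \<delta> \<le> u (F e)) (\<lambda>e. \<delta>' \<le> u (F e))"
proof -
  define ramp where "ramp x = max 0 (min 1 ((\<delta> - x) / (\<delta> - \<delta>')))" for x
  have ramp: "ramp x = 0" if "\<delta> \<le> x" for x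
    using that assms(3) by (simp add: ramp_def divide_nonpos_pos)
  have ramp': "ramp x = 1" if "\<not> \<delta>' \<le> x" for x
    using that assms(3) by (simp add: ramp_def field_simps)
  have "definable V (\<lambda>e. ramp (u (F e)))"
    using assms(1)
  proof (rule definable_unary)
    show "continuous_on {0..1} (\<lambda>x. ramp (u x))"
      unfolding ramp_def using assms(2,3) by (intro continuous_intros) auto
  qed (auto simp: ramp_def)
  then show ?thesis
    by (rule separatedI) (simp_all add: ramp ramp')
qed

end

section \<open>Alternations along a linear order\<close>

lemma card_convex_boundary_le_2:
  fixes S :: "nat set"
  assumes "\<And>i j k. i \<in> S \<Longrightarrow> k \<in> S \<Longrightarrow> i \<le> j \<Longrightarrow> j \<le> k \<Longrightarrow> j \<in> S"
  shows "finite {j. (j \<in> S) \<noteq> (Suc j \<in> S)} \<and> card {j. (j \<in> S) \<noteq> (Suc j \<in> S)} \<le> 2"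
proof -
  let ?A = "{j. j \<notin> S \<and> Suc j \<in> S}" and ?B = "{j. j \<in> S \<and> Suc j \<notin> S}"
  have "i = j" if "i \<in> ?A" "j \<in> ?A" for i j
    using that assms[of "Suc i" "Suc j" j] assms[of "Suc j" "Suc i" i]
    by (cases i j rule: linorder_cases) auto
  then obtain a where "?A \<subseteq> {a}" by blast
  moreover have "i = j" if "i \<in> ?B" "j \<in> ?B" for i j
    using that assms[of i j "Suc i"] assms[of j i "Suc j"] by (cases i j rule: linorder_cases) auto
  then obtain b where "?B \<subseteq> {b}" by blast
  ultimately have "{j. (j \<in> S) \<noteq> (Suc j \<in> S)} \<subseteq> {a, b}" by blast
  moreover have "card {a, b} \<le> 2"
    by (simp add: card_insert_if)
  ultimately show ?thesis
    using card_mono[of "{a, b}"] finite_subset[of _ "{a, b}"]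
    by (meson finite.emptyI finite_insert order_trans)
qed

locale linear_order_set =
  fixes X :: "'m set" and R :: "'m rel"
  assumes linear_order: "linear_order_on X R"
begin

lemma le_refl: "x \<in> X \<Longrightarrow> (x, x) \<in> R"
  using linear_order by (simp add: order_on_defs refl_on_def)

lemma le_trans: "(x, y) \<in> R \<Longrightarrow> (y, z) \<in> R \<Longrightarrow> (x, z) \<in> R"
  using linear_order unfolding order_on_defs by (elim conjE) (rule transD)

lemma le_linear: "x \<in> X \<Longrightarrow> y \<in> X \<Longrightarrow> (x, y) \<in> R \<or> (y, x) \<in> R"
  using linear_order le_refl[of x] unfolding order_on_defs total_on_def by (cases "x = y") simp_all

text \<open>\<open>above_alternation f \<mu> \<delta> m\<close> is the final segment of the elements that lie above some
  \<open>x\<^sub>0 \<le> \<dots> \<le> x\<^bsub>m-1\<^esub>\<close> with \<open>f x\<^sub>0 \<ge> \<mu> + \<delta>\<close>, \<open>f x\<^sub>1 \<le> \<mu> - \<delta>\<close>, \<open>f x\<^sub>2 \<ge> \<mu> + \<delta>\<close> and so on.\<close>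

primrec above_alternation :: "('m \<Rightarrow> real) \<Rightarrow> real \<Rightarrow> real \<Rightarrow> nat \<Rightarrow> 'm set" where
  "above_alternation f \<mu> \<delta> 0 = X"
| "above_alternation f \<mu> \<delta> (Suc m) =
     {y \<in> X. \<exists>x\<in>above_alternation f \<mu> \<delta> m. \<delta> \<le> (- 1) ^ m * (f x - \<mu>) \<and> (x, y) \<in> R}"

lemma above_alternation_in_carrier: "x \<in> above_alternation f \<mu> \<delta> m \<Longrightarrow> x \<in> X"
  by (cases m) auto

lemma above_alternation_upward_closed:
  "x \<in> above_alternation f \<mu> \<delta> m \<Longrightarrow> y \<in> X \<Longrightarrow> (x, y) \<in> R \<Longrightarrow> y \<in> above_alternation f \<mu> \<delta> m"
  using le_trans by (cases m) (simp, simp, blast)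

lemma above_alternation_linear:
  "above_alternation f \<mu> \<delta> m \<subseteq> above_alternation g \<nu> \<epsilon> k \<or>
   above_alternation g \<nu> \<epsilon> k \<subseteq> above_alternation f \<mu> \<delta> m"
proof (rule ccontr)
  assume "\<not> ?thesis"
  then obtain x y where xy: "x \<in> above_alternation f \<mu> \<delta> m" "x \<notin> above_alternation g \<nu> \<epsilon> k"
    "y \<in> above_alternation g \<nu> \<epsilon> k" "y \<notin> above_alternation f \<mu> \<delta> m"
    by blast
  then have "x \<in> X" "y \<in> X"
    by (auto intro: above_alternation_in_carrier)
  with xy show False
    using le_linear[of x y] above_alternation_upward_closed by blast
qed

lemma above_alternation_antimono:
  assumes "\<delta>' \<le> \<delta>"
  shows "above_alternation f \<mu> \<delta> m \<subseteq> above_alternation f \<mu> \<delta>' m"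
proof (induction m)
  case (Suc m)
  have "\<delta>' \<le> (- 1) ^ m * (f x - \<mu>)" if "\<delta> \<le> (- 1) ^ m * (f x - \<mu>)" for x
    using assms that by (rule order_trans)
  with Suc show ?case by force
qed simp

lemma above_alternation_SucI:
  "x \<in> above_alternation f \<mu> \<delta> m \<Longrightarrow> \<delta> \<le> (- 1) ^ m * (f x - \<mu>) \<Longrightarrow>
   x \<in> above_alternation f \<mu> \<delta> (Suc m)"
  using above_alternation_in_carrier le_refl by auto

lemma above_alternation_chain:
  assumes "y \<in> above_alternation f \<mu> \<delta> m"
  obtains p :: "nat \<Rightarrow> 'm" where "range p \<subseteq> X" "\<And>j. (p j, p (Suc j)) \<in> R"
    "\<And>j. j < m \<Longrightarrow> \<delta> \<le> (- 1) ^ j * (f (p j) - \<mu>)"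
proof -
  have "\<exists>p. range p \<subseteq> X \<and> (\<forall>j. (p j, p (Suc j)) \<in> R \<and> (p j, y) \<in> R) \<and>
      (\<forall>j<m. \<delta> \<le> (- 1) ^ j * (f (p j) - \<mu>))"
    using assms
  proof (induction m arbitrary: y)
    case 0
    then show ?case
      using le_refl by (intro exI[of _ "\<lambda>_. y"]) auto
  next
    case (Suc m)
    then obtain x where x: "x \<in> above_alternation f \<mu> \<delta> m" "\<delta> \<le> (- 1) ^ m * (f x - \<mu>)" "(x, y) \<in> R"
      by auto
    have "x \<in> X"
      using x(1) by (rule above_alternation_in_carrier)
    obtain p where p: "range p \<subseteq> X" "\<And>j. (p j, p (Suc j)) \<in> R" "\<And>j. (p j, x) \<in> R"
      "\<And>j. j < m \<Longrightarrow> \<delta> \<le> (- 1) ^ j * (f (p j) - \<mu>)"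
      using Suc.IH[OF x(1)] by auto
    show ?case
      using p x \<open>x \<in> X\<close> le_refl le_trans[OF p(3) x(3)]
      by (intro exI[of _ "\<lambda>j. if j < m then p j else x"]) (auto simp: less_Suc_eq)
  qed
  then show ?thesis
    using that by blast
qed

lemma chain_mono:
  fixes p :: "nat \<Rightarrow> 'm"
  assumes "range p \<subseteq> X" "\<And>j. (p j, p (Suc j)) \<in> R" "i \<le> j"
  shows "(p i, p j) \<in> R"
  using assms(3)
proof (induction j rule: dec_induct)
  case base
  show ?case using assms(1) le_refl by auto
next
  case (step j)
  then show ?case using assms(2) le_trans by blast
qed

lemma card_order_convex_boundary_le_2:
  fixes p :: "nat \<Rightarrow> 'm"
  assumes "order_convex X R C" "range p \<subseteq> X" "\<And>j. (p j, p (Suc j)) \<in> R"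
  shows "finite {j. (p j \<in> C) \<noteq> (p (Suc j) \<in> C)} \<and> card {j. (p j \<in> C) \<noteq> (p (Suc j) \<in> C)} \<le> 2"
proof -
  let ?S = "{j. p j \<in> C}"
  have "finite {j. (j \<in> ?S) \<noteq> (Suc j \<in> ?S)} \<and> card {j. (j \<in> ?S) \<noteq> (Suc j \<in> ?S)} \<le> 2"
  proof (rule card_convex_boundary_le_2)
    fix i j k assume "i \<in> ?S" "k \<in> ?S" "i \<le> j" "j \<le> k"
    then have "p i \<in> C" "p k \<in> C" "p j \<in> X" "(p i, p j) \<in> R" "(p j, p k) \<in> R"
      using assms(2) chain_mono[OF assms(2,3)] by auto
    then show "j \<in> ?S"
      using assms(1) unfolding order_convex_def by blast
  qed
  then show ?thesis by simp
qed

lemma convex_span_jumps_bounded: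
  assumes "g \<in> convex_span X R"
  obtains K where "\<And>p :: nat \<Rightarrow> 'm. range p \<subseteq> X \<Longrightarrow> (\<And>j. (p j, p (Suc j)) \<in> R) \<Longrightarrow>
    finite {j. g (p j) \<noteq> g (p (Suc j))} \<and> card {j. g (p j) \<noteq> g (p (Suc j))} \<le> K"
proof -
  obtain k c and C :: "nat \<Rightarrow> 'm set" where C: "\<And>i. i < k \<Longrightarrow> order_convex X R (C i)"
    and g: "g = (\<lambda>x. \<Sum>i<k. c i * indicat_real (C i) x)"
    using assms unfolding convex_span_def by blast
  show ?thesis
  proof (rule that[of "2 * k"])
    fix p :: "nat \<Rightarrow> 'm" assume p: "range p \<subseteq> X" "\<And>j. (p j, p (Suc j)) \<in> R"
    define D where "D i = {j. (p j \<in> C i) \<noteq> (p (Suc j) \<in> C i)}" for i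
    have D: "finite (D i) \<and> card (D i) \<le> 2" if "i < k" for i
      unfolding D_def by (rule card_order_convex_boundary_le_2[OF C[OF that] p])
    have jumps: "{j. g (p j) \<noteq> g (p (Suc j))} \<subseteq> (\<Union>i<k. D i)"
    proof
      fix j assume "j \<in> {j. g (p j) \<noteq> g (p (Suc j))}"
      moreover have "g (p j) = g (p (Suc j))" if "\<And>i. i < k \<Longrightarrow> (p j \<in> C i) = (p (Suc j) \<in> C i)"
        unfolding g using that by (intro sum.cong) (auto simp: indicator_def)
      ultimately show "j \<in> (\<Union>i<k. D i)"
        unfolding D_def by blast
    qed
    have "card (\<Union>i<k. D i) \<le> (\<Sum>i<k. card (D i))"
      by (rule card_UN_le) simp
    also have "\<dots> \<le> (\<Sum>i<k. 2)"
      using D by (intro sum_mono) auto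
    finally have "card (\<Union>i<k. D i) \<le> 2 * k"
      by simp
    moreover have "finite (\<Union>i<k. D i)"
      using D by auto
    ultimately show "finite {j. g (p j) \<noteq> g (p (Suc j))} \<and> card {j. g (p j) \<noteq> g (p (Suc j))} \<le> 2 * k"
      using finite_subset[OF jumps] card_mono[OF _ jumps] by auto
  qed
qed

lemma above_alternation_empty_if_near_convex_span:
  assumes "g \<in> convex_span X R" and near: "\<And>x. x \<in> X \<Longrightarrow> \<bar>g x - f x\<bar> < \<delta>"
  shows "\<exists>N. above_alternation f \<mu> \<delta> N = {}"
proof -
  obtain K where K: "\<And>p :: nat \<Rightarrow> 'm. range p \<subseteq> X \<Longrightarrow> (\<And>j. (p j, p (Suc j)) \<in> R) \<Longrightarrow>
      finite {j. g (p j) \<noteq> g (p (Suc j))} \<and> card {j. g (p j) \<noteq> g (p (Suc j))} \<le> K"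
    using convex_span_jumps_bounded[OF assms(1)] by blast
  have False if y: "y \<in> above_alternation f \<mu> \<delta> (K + 2)" for y
  proof -
    obtain p where p: "range p \<subseteq> X" "\<And>j. (p j, p (Suc j)) \<in> R"
      and alternates: "\<And>j. j < K + 2 \<Longrightarrow> \<delta> \<le> (- 1) ^ j * (f (p j) - \<mu>)"
      using above_alternation_chain[OF y] by blast
    have "g (p j) \<noteq> g (p (Suc j))" if "j \<le> K" for j
    proof -
      have "\<bar>g (p j) - f (p j)\<bar> < \<delta>" "\<bar>g (p (Suc j)) - f (p (Suc j))\<bar> < \<delta>"
        using near p(1) by auto
      then show ?thesis
        using alternates[of j] alternates[of "Suc j"] that by (cases "even j") auto
    qed
    then have "{..K} \<subseteq> {j. g (p j) \<noteq> g (p (Suc j))}"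
      by auto
    then have "card {..K} \<le> card {j. g (p j) \<noteq> g (p (Suc j))}"
      using K[OF p] by (intro card_mono) auto
    then show False
      using K[OF p] by simp
  qed
  then show ?thesis by blast
qed

end

locale metric_order =
  fixes D :: "'m metric" and R :: "'m rel"
  assumes metric_linear_order: "metric_linear_order D R"
begin

sublocale linear_order_set "mspace D" R
  using metric_linear_order unfolding metric_linear_order_def by unfold_locales (rule conjunct1)

lemma dist_between:
  assumes "x \<in> mspace D" "y \<in> mspace D" "z \<in> mspace D" "(y, z) \<in> R" "(z, x) \<in> R"
    and "mdist D x y < \<eta>"
  shows "mdist D x z < \<eta>"
proof -
  have "\<eta> > 0"
    using assms(6) Metric_space.nonneg[OF Metric_space_mspace_mdist] by (meson le_less_trans)
  then have "order_convex (mspace D) R (mball_of D x \<eta>)"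
    using metric_linear_order assms(1) unfolding metric_linear_order_def by blast
  moreover have "x \<in> mball_of D x \<eta>" "y \<in> mball_of D x \<eta>"
    using assms \<open>\<eta> > 0\<close> by (simp_all add: Metric_space.mdist_zero[OF Metric_space_mspace_mdist])
  ultimately have "z \<in> mball_of D x \<eta>"
    using assms unfolding order_convex_def by blast
  then show ?thesis by simp
qed

lemma above_alternation_close_below:
  assumes unif: "\<And>x y. x \<in> mspace D \<Longrightarrow> y \<in> mspace D \<Longrightarrow> mdist D x y < \<eta> \<Longrightarrow> \<bar>f x - f y\<bar> \<le> \<kappa>"
    and \<kappa>: "0 \<le> \<kappa>" "\<kappa> < \<delta>" and x: "x \<in> above_alternation f \<mu> \<delta> m" "\<delta> \<le> (- 1) ^ m * (f x - \<mu>)"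
    and y: "y \<in> mspace D" "(y, x) \<in> R" "mdist D x y < \<eta>"
  shows "y \<in> above_alternation f \<mu> \<delta> m"
proof (cases m)
  case 0
  then show ?thesis using y(1) by simp
next
  case (Suc k)
  then obtain z where z: "z \<in> above_alternation f \<mu> \<delta> k" "\<delta> \<le> (- 1) ^ k * (f z - \<mu>)" "(z, x) \<in> R"
    using x(1) by auto
  have "x \<in> mspace D" "z \<in> mspace D"
    using x(1) z(1) by (auto intro: above_alternation_in_carrier)
  have "(z, y) \<in> R"
  proof (rule ccontr)
    assume "(z, y) \<notin> R"
    then have "\<bar>f x - f z\<bar> \<le> \<kappa>"
      using unif dist_between[of x y z \<eta>] y z(3) \<open>x \<in> mspace D\<close> \<open>z \<in> mspace D\<close> le_linear by blast
    then show False
      using x(2) z(2) \<kappa> Suc by (cases "even k") auto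
  qed
  then show ?thesis
    using y(1) z Suc by auto
qed

text \<open>An error in the order relation is absorbed by moving the last point of the alternation,
  as consecutive points of an alternation are far apart.\<close>

lemma above_alternation_SucI_close:
  assumes unif: "\<And>x y. x \<in> mspace D \<Longrightarrow> y \<in> mspace D \<Longrightarrow> mdist D x y < \<eta> \<Longrightarrow> \<bar>f x - f y\<bar> \<le> \<kappa>"
    and \<kappa>: "0 \<le> \<kappa>" "\<kappa> < \<delta>" and x: "x \<in> above_alternation f \<mu> \<delta> m" "\<delta> \<le> (- 1) ^ m * (f x - \<mu>)"
    and y: "y \<in> mspace D" "(x, y) \<in> R \<or> mdist D x y < \<eta>"
  shows "y \<in> above_alternation f \<mu> (\<delta> - \<kappa>) (Suc m)"
proof (cases "(x, y) \<in> R")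
  case True
  then have "y \<in> above_alternation f \<mu> \<delta> (Suc m)"
    using x y(1) by auto
  then show ?thesis
    by (rule subsetD[OF above_alternation_antimono, rotated]) (use \<kappa>(1) in simp)
next
  case False
  have "x \<in> mspace D"
    using x(1) by (rule above_alternation_in_carrier)
  with False y have "(y, x) \<in> R" "mdist D x y < \<eta>"
    using le_linear by auto
  then have "y \<in> above_alternation f \<mu> \<delta> m"
    using above_alternation_close_below[of \<eta> f \<kappa> \<delta> x \<mu> m y] unif \<kappa> x y(1) by blast
  then have "y \<in> above_alternation f \<mu> (\<delta> - \<kappa>) m"
    by (rule subsetD[OF above_alternation_antimono, rotated]) (use \<kappa>(1) in simp)
  moreover have "\<delta> - \<kappa> \<le> (- 1) ^ m * (f y - \<mu>)"
    using unif[OF \<open>x \<in> mspace D\<close> y(1) \<open>mdist D x y < \<eta>\<close>] x(2) by (cases "even m") auto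
  ultimately show ?thesis
    by (rule above_alternation_SucI)
qed

end

section \<open>Alternations of a definable family\<close>

locale mlo_structure = cl_structure L M
  for L :: "('f, 'p) cl_lang" and M :: "('f, 'p, 'm) cl_struct" +
  fixes r :: 'p and R :: "'m rel"
  assumes r_pred: "r \<in> Preds L" "parity L r = 2" and order: "MLO_order r M R"
begin

sublocale metric_order "met M" R
  using order unfolding MLO_order_def by unfold_locales (rule conjunct1)

lemma pint_r_eq:
  "x \<in> univ M \<Longrightarrow> y \<in> univ M \<Longrightarrow>
   pint M r [x, y] = (INF z\<in>{z \<in> univ M. (z, y) \<in> R}. mdist (met M) x z)"
  using order unfolding MLO_order_def by simp

lemma pint_r_le_0:
  assumes "x \<in> univ M" "y \<in> univ M" "(x, y) \<in> R"
  shows "pint M r [x, y] \<le> 0"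
proof -
  have "(INF z\<in>{z \<in> univ M. (z, y) \<in> R}. mdist (met M) x z) \<le> mdist (met M) x x"
    using assms Metric_space.nonneg[OF Metric_space_mspace_mdist]
    by (intro cINF_lower bdd_belowI[of _ 0]) auto
  then show ?thesis
    using assms pint_r_eq mdist_self by simp
qed

lemma le_or_close_if_pint_r_less:
  assumes "x \<in> univ M" "y \<in> univ M" "pint M r [x, y] < \<eta>"
  shows "(x, y) \<in> R \<or> mdist (met M) x y < \<eta>"
proof (rule ccontr)
  assume far: "\<not> ((x, y) \<in> R \<or> mdist (met M) x y < \<eta>)"
  then have "(y, x) \<in> R"
    using le_linear assms by blast
  have "\<eta> \<le> (INF z\<in>{z \<in> univ M. (z, y) \<in> R}. mdist (met M) x z)"
  proof (rule cINF_greatest)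
    show "{z \<in> univ M. (z, y) \<in> R} \<noteq> {}"
      using assms le_refl by blast
    fix z assume "z \<in> {z \<in> univ M. (z, y) \<in> R}"
    then have "\<not> mdist (met M) x z < \<eta>"
      using far dist_between[of x z y \<eta>] assms \<open>(y, x) \<in> R\<close> by blast
    then show "\<eta> \<le> mdist (met M) x z" by simp
  qed
  then show False
    using assms pint_r_eq by simp
qed

lemma separated_le:
  assumes "\<eta> > 0"
  shows "separated {x, y} (\<lambda>e. (e x, e y) \<in> R)
    (\<lambda>e. (e x, e y) \<in> R \<or> mdist (met M) (e x) (e y) < \<eta>)"
proof -
  have "definable {x, y} (\<lambda>e. pint M r [e x, e y])"
    by (rule definableI[of "Pred r [Var 0, Var 1]" "\<lambda>v. if v = 0 then x else y"])
      (auto simp: r_pred)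
  then have "separated {x, y} (\<lambda>e. 0 \<le> - pint M r [e x, e y]) (\<lambda>e. - (\<eta>/2) \<le> - pint M r [e x, e y])"
    by (rule separated_ge) (use assms in \<open>auto intro!: continuous_intros\<close>)
  then show ?thesis
  proof (rule separated_mono[OF _ order_refl])
    fix e assume "e \<in> {x, y} \<rightarrow> univ M"
    then have e: "e x \<in> univ M" "e y \<in> univ M" by auto
    show "0 \<le> - pint M r [e x, e y]" if "(e x, e y) \<in> R"
      using pint_r_le_0[OF e that] by simp
    show "(e x, e y) \<in> R \<or> mdist (met M) (e x) (e y) < \<eta>" if "- (\<eta>/2) \<le> - pint M r [e x, e y]"
      using that assms by (intro le_or_close_if_pint_r_less e) simp
  qed
qed

lemma separated_ex_le:
  assumes "separated (adjoin V) (\<lambda>e. P (e \<circ> Some) (e None)) (\<lambda>e. Q (e \<circ> Some) (e None))" "\<eta> > 0"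
  shows "separated (adjoin V) (\<lambda>e. \<exists>x\<in>univ M. P (e \<circ> Some) x \<and> (x, e None) \<in> R)
    (\<lambda>e. \<exists>x\<in>univ M. Q (e \<circ> Some) x \<and> ((x, e None) \<in> R \<or> mdist (met M) x (e None) < \<eta>))"
proof (rule separated_ex, rule separated_conj)
  show "separated (adjoin (adjoin V)) (\<lambda>e. P (e \<circ> Some \<circ> Some) (e None))
    (\<lambda>e. Q (e \<circ> Some \<circ> Some) (e None))"
  proof -
    have "map_option Some ` adjoin V \<subseteq> adjoin (adjoin V)"
      by auto
    from separated_reindex[OF assms(1) this] show ?thesis
      by (simp add: comp_def)
  qed
  show "separated (adjoin (adjoin V)) (\<lambda>e. (e None, (e \<circ> Some) None) \<in> R)
    (\<lambda>e. (e None, (e \<circ> Some) None) \<in> R \<or> mdist (met M) (e None) ((e \<circ> Some) None) < \<eta>)"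
    by (rule separated_mono[OF separated_le[OF assms(2)]]) auto
qed

lemma separated_above_alternation:
  assumes "definable (adjoin V) F" "0 < \<delta>'" "\<delta>' < \<delta>"
  shows "separated (adjoin V) (\<lambda>e. e None \<in> above_alternation (slice F (e \<circ> Some)) \<mu> \<delta> m)
    (\<lambda>e. e None \<in> above_alternation (slice F (e \<circ> Some)) \<mu> \<delta>' m)"
  using assms(2,3)
proof (induction m arbitrary: \<delta> \<delta>')
  case 0
  show ?case
    by (rule separated_mono[OF separated_True]) auto
next
  case (Suc m)
  define \<epsilon> where "\<epsilon> = (\<delta> + \<delta>') / 2"
  have \<epsilon>: "\<delta>' < \<epsilon>" "\<epsilon> < \<delta>" "0 < \<epsilon> - \<delta>'"
    using Suc.prems by (simp_all add: \<epsilon>_def)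
  obtain \<eta> where "\<eta> > 0" and \<eta>: "\<And>e x y. e \<in> V \<rightarrow> univ M \<Longrightarrow> x \<in> univ M \<Longrightarrow> y \<in> univ M \<Longrightarrow>
      mdist (met M) x y < \<eta> \<Longrightarrow> \<bar>slice F e x - slice F e y\<bar> \<le> \<epsilon> - \<delta>'"
    using slice_uniformly_continuous[OF assms(1) \<epsilon>(3)] by blast
  let ?turns = "\<lambda>\<delta> e x. x \<in> above_alternation (slice F e) \<mu> \<delta> m \<and> \<delta> \<le> (- 1) ^ m * (slice F e x - \<mu>)"
  have "separated (adjoin V) (\<lambda>e. ?turns \<delta> (e \<circ> Some) (e None)) (\<lambda>e. ?turns \<epsilon> (e \<circ> Some) (e None))"
    unfolding slice_comp_Some
  proof (rule separated_conj)
    show "separated (adjoin V) (\<lambda>e. \<delta> \<le> (- 1) ^ m * (F e - \<mu>)) (\<lambda>e. \<epsilon> \<le> (- 1) ^ m * (F e - \<mu>))"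
      using assms(1) by (rule separated_ge) (use \<epsilon> in \<open>auto intro!: continuous_intros\<close>)
  qed (rule Suc.IH; use Suc.prems \<epsilon> in simp)
  from separated_ex_le[OF this \<open>\<eta> > 0\<close>] show ?case
  proof (rule separated_mono[OF _ order_refl])
    fix e assume e: "e \<in> adjoin V \<rightarrow> univ M"
    show "\<exists>x\<in>univ M. ?turns \<delta> (e \<circ> Some) x \<and> (x, e None) \<in> R"
      if "e None \<in> above_alternation (slice F (e \<circ> Some)) \<mu> \<delta> (Suc m)"
      using that by (auto intro: above_alternation_in_carrier)
    assume "\<exists>x\<in>univ M. ?turns \<epsilon> (e \<circ> Some) x \<and> ((x, e None) \<in> R \<or> mdist (met M) x (e None) < \<eta>)"
    then obtain x where x: "?turns \<epsilon> (e \<circ> Some) x" "(x, e None) \<in> R \<or> mdist (met M) x (e None) < \<eta>"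
      by blast
    have "e None \<in> above_alternation (slice F (e \<circ> Some)) \<mu> (\<epsilon> - (\<epsilon> - \<delta>')) (Suc m)"
      by (rule above_alternation_SucI_close[OF \<eta>]) (use e x \<epsilon> Suc.prems in auto)
    then show "e None \<in> above_alternation (slice F (e \<circ> Some)) \<mu> \<delta>' (Suc m)"
      by simp
  qed
qed

lemma separated_above_alternation_subset:
  assumes "definable (adjoin V) F" "definable (adjoin V) G" "0 < \<delta>'" "\<delta>' < \<epsilon>" "\<epsilon> < \<delta>"
  shows "separated V
    (\<lambda>e. above_alternation (slice F e) \<mu> \<epsilon> m \<subseteq> above_alternation (slice G e) \<mu> \<epsilon> m)
    (\<lambda>e. above_alternation (slice F e) \<mu> \<delta> m \<subseteq> above_alternation (slice G e) \<mu> \<delta>' m)"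
proof -
  let ?above = "\<lambda>F \<delta> e x. x \<in> above_alternation (slice F e) \<mu> \<delta> m"
  have "separated (adjoin V) (\<lambda>e. ?above F \<delta> (e \<circ> Some) (e None))
      (\<lambda>e. ?above F \<epsilon> (e \<circ> Some) (e None))"
    "separated (adjoin V) (\<lambda>e. ?above G \<epsilon> (e \<circ> Some) (e None))
      (\<lambda>e. ?above G \<delta>' (e \<circ> Some) (e None))"
    using assms by (auto intro!: separated_above_alternation)
  from separated_conj[OF this(1) separated_not[OF this(2)]]
  have "separated V (\<lambda>e. \<exists>x\<in>univ M. ?above F \<delta> e x \<and> \<not> ?above G \<delta>' e x)
    (\<lambda>e. \<exists>x\<in>univ M. ?above F \<epsilon> e x \<and> \<not> ?above G \<epsilon> e x)"
    by (rule separated_ex)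
  from separated_not[OF this] show ?thesis
    by (rule separated_mono) (auto intro: above_alternation_in_carrier)
qed

lemma above_alternation_slice_eventually_empty:
  assumes "weakly_o_minimal L R M" "definable (adjoin V) F" "e \<in> V \<rightarrow> univ M" "\<delta> > 0"
  shows "\<exists>N. above_alternation (slice F e) \<mu> \<delta> N = {}"
proof -
  obtain g :: "nat \<Rightarrow> 'm \<Rightarrow> real" where g: "\<And>n. g n \<in> convex_span (univ M) R"
    "uniform_limit (univ M) g (slice F e) sequentially"
    using assms(1) definable_pred1_slice[OF assms(2,3)] unfolding weakly_o_minimal_def by blast
  obtain n where "\<forall>x\<in>univ M. dist (g n x) (slice F e x) < \<delta>"
    using eventually_happens'[OF sequentially_bot uniform_limitD[OF g(2) assms(4)]] by blast
  then show ?thesis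
    using g(1)[of n]
    by (intro above_alternation_empty_if_near_convex_span[of "g n"]) (auto simp: dist_real_def)
qed

end

section \<open>Indiscernible sequences\<close>

definition valuation :: "('k \<Rightarrow> 'm list) \<Rightarrow> 'k \<times> nat + 'm \<Rightarrow> 'm" where
  "valuation a = case_sum (\<lambda>(k, p). a k ! p) id"

lemma valuation_reindex: "valuation a \<circ> map_sum (map_prod g id) id = valuation (a \<circ> g)"
  by (auto simp: valuation_def split: sum.split)

definition variables :: "'k list \<Rightarrow> nat \<Rightarrow> 'm list \<Rightarrow> ('k \<times> nat + 'm) list" where
  "variables ks n bs = map Inl (List.product ks [0..<n]) @ map Inr bs"

lemma set_variables: "set (variables ks n bs) = set ks \<times> {..<n} <+> set bs"
  by (auto simp: variables_def)

lemma map_valuation_variables: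
  assumes "\<And>k. k \<in> set ks \<Longrightarrow> length (a k) = n"
  shows "map (valuation a) (variables ks n bs) = concat (map a ks) @ bs"
proof -
  have "map (\<lambda>(k, p). a k ! p) (List.product ks [0..<n]) = concat (map a ks)"
    using assms
  proof (induction ks)
    case (Cons k ks)
    then have "map ((!) (a k)) [0..<n] = a k"
      using map_nth[of "a k"] by simp
    with Cons show ?case by (simp add: comp_def)
  qed simp
  then show ?thesis
    by (simp add: variables_def valuation_def comp_def)
qed

lemma indiscernibleD:
  assumes "indiscernible L M B J a" "set bs \<subseteq> B" "set us \<subseteq> J" "set vs \<subseteq> J" "length us = length vs"
    and "sorted_wrt (<) us" "sorted_wrt (<) vs" "fm_in L (length (concat (map a us) @ bs)) \<phi>"
  shows "value_at M \<phi> (concat (map a us) @ bs) = value_at M \<phi> (concat (map a vs) @ bs)"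
  using assms unfolding indiscernible_def by blast

lemma indiscernible_mono: "indiscernible L M B J a \<Longrightarrow> B' \<subseteq> B \<Longrightarrow> indiscernible L M B' J a"
  unfolding indiscernible_def by (meson order_trans)

lemma indiscernible_if_finite_subsets:
  assumes "\<And>B'. finite B' \<Longrightarrow> B' \<subseteq> B \<Longrightarrow> indiscernible L M B' J a"
  shows "indiscernible L M B J a"
  unfolding indiscernible_def
proof (intro allI impI, elim conjE)
  fix \<phi> bs us vs
  assume "set bs \<subseteq> B" and arguments: "set us \<subseteq> J" "set vs \<subseteq> J" "length us = length vs"
    "sorted_wrt (<) us" "sorted_wrt (<) vs" "fm_in L (length (concat (map a us) @ bs)) \<phi>"
  then have "indiscernible L M (set bs) J a"
    using assms by simp
  then show "value_at M \<phi> (concat (map a us) @ bs) = value_at M \<phi> (concat (map a vs) @ bs)"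
    using order_refl arguments by (rule indiscernibleD)
qed

context cl_structure
begin

lemma definable_variables:
  fixes S :: "'k::linorder set"
  assumes "definable (S \<times> {..<n} <+> B) F"
  obtains ks bs where "set ks \<subseteq> S" "sorted_wrt (<) ks" "set bs \<subseteq> B"
    "definable (set (variables ks n bs)) F"
proof -
  obtain V where V: "finite V" "V \<subseteq> S \<times> {..<n} <+> B" "definable V F"
    using assms by (rule definable_finite_support)
  define ks where "ks = sorted_list_of_set (fst ` (Inl -` V))"
  have finite: "finite (Inl -` V)" "finite (Inr -` V)"
    using V(1) by (simp_all add: finite_vimageI)
  then have ks: "set ks = fst ` (Inl -` V)" "sorted_wrt (<) ks"
    by (simp_all add: ks_def)
  obtain bs where bs: "set bs = Inr -` V"
    using finite_list[OF finite(2)] by auto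
  have "v \<in> set (variables ks n bs)" if "v \<in> V" for v
    using that V(2) by (cases v) (force simp: set_variables ks(1) bs)+
  with V(3) have "definable (set (variables ks n bs)) F"
    by (rule definable_mono[OF _ subsetI])
  moreover have "set ks \<subseteq> S" "set bs \<subseteq> B"
    using V(2) unfolding ks(1) bs by auto
  ultimately show ?thesis
    using ks(2) that by blast
qed

lemma indiscernible_definable:
  fixes S :: "'k::linorder set" and J :: "'i::linorder set"
  assumes "indiscernible L M B J a" and len: "\<And>i. i \<in> J \<Longrightarrow> length (a i) = n"
    and g: "strict_mono_on S g" "g ` S \<subseteq> J" and h: "strict_mono_on S h" "h ` S \<subseteq> J"
    and F: "definable (S \<times> {..<n} <+> B) F"
  shows "F (valuation (a \<circ> g)) = F (valuation (a \<circ> h))"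
proof -
  obtain ks bs where ks: "set ks \<subseteq> S" "sorted_wrt (<) ks" and bs: "set bs \<subseteq> B"
    and "definable (set (variables ks n bs)) F"
    using F by (rule definable_variables)
  then obtain \<phi> where \<phi>: "fm_in L (length (variables ks n bs)) \<phi>"
    "F = (\<lambda>e. value_at M \<phi> (map e (variables ks n bs)))"
    unfolding definable_iff_value_at by blast
  have map_eq: "map (valuation (a \<circ> f)) (variables ks n bs) = concat (map a (map f ks)) @ bs"
    and sorted: "sorted_wrt (<) (map f ks)" and subset: "set (map f ks) \<subseteq> J"
    if "strict_mono_on S f" "f ` S \<subseteq> J" for f
  proof -
    show "set (map f ks) \<subseteq> J"
      using ks(1) that(2) by auto
    then show "map (valuation (a \<circ> f)) (variables ks n bs) = concat (map a (map f ks)) @ bs"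
      by (subst map_valuation_variables) (auto intro!: len)
    show "sorted_wrt (<) (map f ks)"
      unfolding sorted_wrt_map using ks strict_mono_onD[OF that(1)]
      by (auto elim!: sorted_wrt_mono_rel[rotated])
  qed
  have "length (concat (map a (map g ks)) @ bs) = length (variables ks n bs)"
    using map_eq[OF g] by (metis length_map)
  then have "value_at M \<phi> (concat (map a (map g ks)) @ bs) =
      value_at M \<phi> (concat (map a (map h ks)) @ bs)"
    using bs \<phi>(1) g h by (intro indiscernibleD[OF assms(1)] sorted subset) simp_all
  then show ?thesis
    unfolding \<phi>(2) map_eq[OF g] map_eq[OF h] .
qed

lemma indiscernibleI:
  fixes J :: "'i::linorder set"
  assumes len: "\<And>i. i \<in> J \<Longrightarrow> length (a i) = n"
    and eq: "\<And>l g h F. strict_mono_on {..<l} g \<Longrightarrow> g ` {..<l} \<subseteq> J \<Longrightarrow>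
      strict_mono_on {..<l} h \<Longrightarrow> h ` {..<l} \<subseteq> J \<Longrightarrow>
      definable ({..<l::nat} \<times> {..<n} <+> B) F \<Longrightarrow> F (valuation (a \<circ> g)) = F (valuation (a \<circ> h))"
  shows "indiscernible L M B J a"
  unfolding indiscernible_def
proof (intro allI impI, elim conjE)
  fix \<phi> bs us vs
  assume bs: "set bs \<subseteq> B" and us: "set us \<subseteq> J" "sorted_wrt (<) us"
    and vs: "set vs \<subseteq> J" "sorted_wrt (<) vs" and length_eq: "length us = length vs"
    and \<phi>: "fm_in L (length (concat (map a us) @ bs)) \<phi>"
  define ss :: "(nat \<times> nat + 'm) list" where "ss = variables [0..<length us] n bs"
  have map_ss: "map (valuation (a \<circ> (!) ws)) ss = concat (map a ws) @ bs"
    if "set ws \<subseteq> J" "length ws = length us" for ws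
  proof -
    have "map (valuation (a \<circ> (!) ws)) ss = concat (map (a \<circ> (!) ws) [0..<length us]) @ bs"
      unfolding ss_def using that by (intro map_valuation_variables) (auto intro!: len)
    also have "map (a \<circ> (!) ws) [0..<length us] = map a ws"
      unfolding that(2)[symmetric] by (simp add: map_nth flip: map_map)
    finally show ?thesis .
  qed
  have nth: "strict_mono_on {..<length us} ((!) ws)" "(!) ws ` {..<length us} \<subseteq> J"
    if "set ws \<subseteq> J" "length ws = length us" "sorted_wrt (<) ws" for ws
    using that by (auto intro!: strict_mono_onI simp: sorted_wrt_iff_nth_less)
  have "length ss = length (concat (map a us) @ bs)"
    using map_ss[OF us(1)] by (metis length_map)
  then have "definable (set ss) (\<lambda>e. value_at M \<phi> (map e ss))"
    unfolding definable_iff_value_at using \<phi> by auto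
  then have "definable ({..<length us} \<times> {..<n} <+> B) (\<lambda>e. value_at M \<phi> (map e ss))"
    by (rule definable_mono) (use bs in \<open>auto simp: ss_def set_variables\<close>)
  then have "value_at M \<phi> (map (valuation (a \<circ> (!) us)) ss) =
      value_at M \<phi> (map (valuation (a \<circ> (!) vs)) ss)"
    using us vs length_eq by (intro eq[of "length us"] nth) auto
  then show "value_at M \<phi> (concat (map a us) @ bs) = value_at M \<phi> (concat (map a vs) @ bs)"
    using map_ss us vs length_eq by simp
qed

end

section \<open>Inserting the element at the cut\<close>

locale cut_sequence = mlo_structure L M r R
  for L :: "('f, 'p) cl_lang" and M :: "('f, 'p, 'm) cl_struct" and r R +
  fixes I1 I2 :: "('i::linorder) set" and c :: 'i and n :: nat and a :: "'i \<Rightarrow> 'm list"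
  assumes weakly_o_minimal: "weakly_o_minimal L R M"
    and I1: "I1 \<noteq> {}" "\<And>i. i \<in> I1 \<Longrightarrow> i < c" "\<And>i. i \<in> I1 \<Longrightarrow> \<exists>j\<in>I1. i < j"
    and I2: "I2 \<noteq> {}" "\<And>i. i \<in> I2 \<Longrightarrow> c < i" "\<And>i. i \<in> I2 \<Longrightarrow> \<exists>j\<in>I2. j < i"
    and a_in_tuples: "\<And>i. i \<in> I1 \<union> {c} \<union> I2 \<Longrightarrow> a i \<in> tuples M n"
begin

lemma length_a: "i \<in> I1 \<union> {c} \<union> I2 \<Longrightarrow> length (a i) = n"
  using a_in_tuples by (auto simp: tuples_def)

lemma valuation_in_univ:
  assumes "g ` T \<subseteq> I1 \<union> {c} \<union> I2" "B \<subseteq> univ M"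
  shows "valuation (a \<circ> g) \<in> (T \<times> {..<n} <+> B) \<rightarrow> univ M"
proof
  fix s assume "s \<in> T \<times> {..<n} <+> B"
  then show "valuation (a \<circ> g) s \<in> univ M"
  proof
    fix kp assume s: "s = Inl kp" "kp \<in> T \<times> {..<n}"
    then obtain k p where kp: "kp = (k, p)" "k \<in> T" "p < n"
      by auto
    then have "a (g k) \<in> tuples M n"
      using assms(1) by (intro a_in_tuples) auto
    then show ?thesis
      using s kp by (auto simp: valuation_def tuples_def)
  qed (use assms(2) in \<open>auto simp: valuation_def\<close>)
qed

lemma ex_bounds:
  assumes "finite S"
  obtains i j where "i \<in> I1" "\<forall>s\<in>S \<inter> I1. s < i" "j \<in> I2" "\<forall>s\<in>S \<inter> I2. j < s"
proof -
  obtain i0 j0 where i0: "i0 \<in> I1" and j0: "j0 \<in> I2"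
    using I1(1) I2(1) by blast
  have "Max (insert i0 (S \<inter> I1)) \<in> I1" "Min (insert j0 (S \<inter> I2)) \<in> I2"
    using assms i0 j0 Max_in[of "insert i0 (S \<inter> I1)"] Min_in[of "insert j0 (S \<inter> I2)"] by auto
  then obtain i j where "i \<in> I1" "Max (insert i0 (S \<inter> I1)) < i"
    and "j \<in> I2" "j < Min (insert j0 (S \<inter> I2))"
    using I1(3) I2(3) by meson
  then show ?thesis
    using that[of i j] assms by simp
qed

end

locale cut_parameter = cut_sequence L M r R I1 I2 c n a
  for L :: "('f, 'p) cl_lang" and M :: "('f, 'p, 'm) cl_struct" and r R
    and I1 I2 :: "('i::linorder) set" and c n a +
  fixes B :: "'m set" and b :: 'm
  assumes B: "B \<subseteq> univ M" and b: "b \<in> univ M"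
    and indiscernible: "indiscernible L M B (I1 \<union> {c} \<union> I2) a"
    and indiscernible_b: "indiscernible L M (insert b B) (I1 \<union> I2) a"

locale cut_family = cut_parameter L M r R I1 I2 c n a B b
  for L :: "('f, 'p) cl_lang" and M :: "('f, 'p, 'm) cl_struct" and r R
    and I1 I2 :: "('i::linorder) set" and c n a B b +
  fixes F :: "(('i \<times> nat + 'm) option \<Rightarrow> 'm) \<Rightarrow> real" and S :: "'i set" and i j :: 'i
  assumes definable: "definable (adjoin (S \<times> {..<n} <+> B)) F"
    and S: "S \<subseteq> I1 \<union> {c} \<union> I2" "\<And>s. s \<in> S \<Longrightarrow> s \<noteq> c \<Longrightarrow> s < i \<or> j < s"
    and i: "i \<in> I1" and j: "j \<in> I2"
begin

lemma i_less_c_less_j: "i < c" "c < j"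
  using I1(2) I2(2) i j by auto

lemma i_notin_S: "i \<notin> S"
  using S(2)[of i] i_less_c_less_j by (metis less_irrefl less_trans)

definition fibre :: "'i \<Rightarrow> 'm \<Rightarrow> real" where
  "fibre q = slice F (valuation (a \<circ> id(c := q)))"

lemma slice_eq_fibre:
  assumes "\<And>s. s \<in> S \<Longrightarrow> g s = (id(c := q)) s"
  shows "slice F (valuation (a \<circ> g)) = fibre q"
  unfolding fibre_def slice_def
proof (rule ext, rule definable_cong[OF definable])
  fix x s assume "s \<in> adjoin (S \<times> {..<n} <+> B)"
  then show "case_option x (valuation (a \<circ> g)) s = case_option x (valuation (a \<circ> id(c := q))) s"
    using assms by (auto simp: valuation_def)
qed

lemma definable_eq_over_b:
  assumes "definable (adjoin (S \<times> {..<n} <+> B)) G" "q \<in> {i, j}" "q' \<in> {i, j}"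
  shows "G (case_option b (valuation (a \<circ> id(c := q)))) =
    G (case_option b (valuation (a \<circ> id(c := q'))))"
proof -
  have strict_mono: "strict_mono_on S (id(c := q))" if "q \<in> {i, j}" for q
    using that S(2) i_less_c_less_j by (intro strict_mono_onI) (auto dest: less_trans)
  have range: "id(c := q) ` S \<subseteq> I1 \<union> I2" if "q \<in> {i, j}" for q
    using that S(1) i j by auto
  have "definable (S \<times> {..<n} <+> insert b B) (\<lambda>e. G (e \<circ> case_option (Inr b) id))"
    using assms(1) by (rule definable_reindex) auto
  then have "G (valuation (a \<circ> id(c := q)) \<circ> case_option (Inr b) id) =
      G (valuation (a \<circ> id(c := q')) \<circ> case_option (Inr b) id)"
    using indiscernible_definable[OF indiscernible_b _ strict_mono[OF assms(2)] range[OF assms(2)]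
        strict_mono[OF assms(3)] range[OF assms(3)]] length_a by blast
  moreover have "valuation d \<circ> case_option (Inr b) id = case_option b (valuation d)"
    for d :: "'i \<Rightarrow> 'm list"
    by (auto simp: valuation_def split: option.split)
  ultimately show ?thesis by simp
qed

lemma fibre_i_eq_fibre_j: "fibre i b = fibre j b"
  unfolding fibre_def slice_def using definable by (rule definable_eq_over_b) simp_all

lemma above_alternation_fibre_transfer:
  assumes "b \<in> above_alternation (fibre q) \<mu> \<delta> m" "q \<in> {i, j}" "q' \<in> {i, j}" "0 < \<delta>'" "\<delta>' < \<delta>"
  shows "b \<in> above_alternation (fibre q') \<mu> \<delta>' m"
proof -
  let ?e = "\<lambda>q. case_option b (valuation (a \<circ> id(c := q)))"
  have in_univ: "?e q \<in> adjoin (S \<times> {..<n} <+> B) \<rightarrow> univ M" if "q \<in> {i, j}" for q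
    using that S(1) i j by (intro case_option_in_Pi valuation_in_univ B b) auto
  have slice: "slice F (?e q \<circ> Some) = fibre q" "?e q None = b" for q
    by (simp_all add: fibre_def comp_def)
  have "?e q' None \<in> above_alternation (slice F (?e q' \<circ> Some)) \<mu> \<delta>' m"
  proof (rule separated_transfer[OF separated_above_alternation[OF definable assms(4,5)]])
    show "?e q None \<in> above_alternation (slice F (?e q \<circ> Some)) \<mu> \<delta> m"
      unfolding slice by (rule assms(1))
    show "G (?e q) = G (?e q')" if "definable (adjoin (S \<times> {..<n} <+> B)) G" for G
      using that assms(2,3) by (rule definable_eq_over_b)
  qed (use in_univ assms(2,3) in simp_all)
  then show ?thesis
    unfolding slice .
qed

lemma separated_transfer_shift:
  assumes "separated (insert i (insert c S) \<times> {..<n} <+> B) P Q" "P (valuation a)"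
  shows "Q (valuation (a \<circ> id(i := c, c := j)))"
proof -
  let ?T = "insert i (insert c S)" and ?h = "id(i := c, c := j)"
  have position: "s < i \<and> ?h s = s \<or> s = i \<and> ?h s = c \<or> s = c \<and> ?h s = j \<or> j < s \<and> ?h s = s"
    if "s \<in> ?T" for s
    using that S(2)[of s] i_less_c_less_j by auto
  have T: "id ` ?T \<subseteq> I1 \<union> {c} \<union> I2" "?h ` ?T \<subseteq> I1 \<union> {c} \<union> I2"
    using S(1) i j by auto
  have strict_mono_id: "strict_mono_on ?T id"
    by (simp add: strict_mono_onI)
  have strict_mono_shift: "strict_mono_on ?T ?h"
  proof (rule strict_mono_onI)
    fix s t assume s: "s \<in> ?T" and t: "t \<in> ?T" and "s < t"
    with i_less_c_less_j show "?h s < ?h t"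
      using position[OF s] position[OF t] by (elim disjE conjE; order)
  qed
  have "G (valuation a) = G (valuation (a \<circ> ?h))" if "definable (?T \<times> {..<n} <+> B) G" for G
    using indiscernible_definable[OF indiscernible length_a strict_mono_id T(1)
        strict_mono_shift T(2) that] by simp
  then show ?thesis
    using assms valuation_in_univ[OF T(1) B] valuation_in_univ[OF T(2) B]
    by (auto intro: separated_transfer[OF assms(1)])
qed

lemma above_alternation_fibre_shift:
  assumes "0 < \<delta>'" "\<delta>' < \<epsilon>" "\<epsilon> < \<delta>"
  shows "above_alternation (fibre i) \<mu> \<epsilon> m \<subseteq> above_alternation (fibre c) \<mu> \<epsilon> m \<Longrightarrow>
      above_alternation (fibre c) \<mu> \<delta> m \<subseteq> above_alternation (fibre j) \<mu> \<delta>' m"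
    and "above_alternation (fibre c) \<mu> \<epsilon> m \<subseteq> above_alternation (fibre i) \<mu> \<epsilon> m \<Longrightarrow>
      above_alternation (fibre j) \<mu> \<delta> m \<subseteq> above_alternation (fibre c) \<mu> \<delta>' m"
proof -
  let ?V = "insert i (insert c S) \<times> {..<n} <+> B"
  define \<tau> :: "'i \<times> nat + 'm \<Rightarrow> 'i \<times> nat + 'm" where "\<tau> = map_sum (map_prod (id(c := i)) id) id"
  define F_i where "F_i e = F (e \<circ> map_option \<tau>)" for e
  have F_i: "definable (adjoin ?V) F_i"
    unfolding F_i_def using definable by (rule definable_reindex) (auto simp: \<tau>_def)
  have F_c: "definable (adjoin ?V) F"
    using definable by (rule definable_mono) auto
  have slice: "slice F_i (valuation d) = slice F (valuation (d \<circ> id(c := i)))" for d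
    unfolding F_i_def slice_map_option \<tau>_def valuation_reindex ..
  have at_i_c: "slice F_i (valuation a) = fibre i" "slice F (valuation a) = fibre c"
    unfolding slice fibre_def by (simp_all add: fun_upd_idem)
  have at_c_j: "slice F_i (valuation (a \<circ> id(i := c, c := j))) = fibre c"
    "slice F (valuation (a \<circ> id(i := c, c := j))) = fibre j"
    unfolding slice comp_assoc using i_notin_S by (auto intro!: slice_eq_fibre)
  show "above_alternation (fibre c) \<mu> \<delta> m \<subseteq> above_alternation (fibre j) \<mu> \<delta>' m"
    if "above_alternation (fibre i) \<mu> \<epsilon> m \<subseteq> above_alternation (fibre c) \<mu> \<epsilon> m"
    using that separated_transfer_shift[OF separated_above_alternation_subset[OF F_i F_c assms]]
    unfolding at_i_c at_c_j by blast
  show "above_alternation (fibre j) \<mu> \<delta> m \<subseteq> above_alternation (fibre c) \<mu> \<delta>' m"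
    if "above_alternation (fibre c) \<mu> \<epsilon> m \<subseteq> above_alternation (fibre i) \<mu> \<epsilon> m"
    using that separated_transfer_shift[OF separated_above_alternation_subset[OF F_c F_i assms]]
    unfolding at_i_c at_c_j by blast
qed

lemma above_alternation_fibre_monotone:
  assumes "0 < \<delta>'" "\<delta>' < \<delta>"
  shows "above_alternation (fibre i) \<mu> \<delta> m \<subseteq> above_alternation (fibre c) \<mu> \<delta>' m \<and>
      above_alternation (fibre c) \<mu> \<delta> m \<subseteq> above_alternation (fibre j) \<mu> \<delta>' m \<or>
    above_alternation (fibre c) \<mu> \<delta> m \<subseteq> above_alternation (fibre i) \<mu> \<delta>' m \<and>
      above_alternation (fibre j) \<mu> \<delta> m \<subseteq> above_alternation (fibre c) \<mu> \<delta>' m"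
proof -
  obtain \<epsilon> where \<epsilon>: "\<delta>' < \<epsilon>" "\<epsilon> < \<delta>"
    using assms(2) dense by blast
  have weaken: "above_alternation f \<mu> \<delta> m \<subseteq> above_alternation g \<mu> \<delta>' m"
    if "above_alternation f \<mu> \<epsilon> m \<subseteq> above_alternation g \<mu> \<epsilon> m" for f g
    using that above_alternation_antimono[of \<epsilon> \<delta>] above_alternation_antimono[of \<delta>' \<epsilon>] \<epsilon>
    by (meson less_imp_le order_trans)
  consider (increasing) "above_alternation (fibre i) \<mu> \<epsilon> m \<subseteq> above_alternation (fibre c) \<mu> \<epsilon> m"
    | (decreasing) "above_alternation (fibre c) \<mu> \<epsilon> m \<subseteq> above_alternation (fibre i) \<mu> \<epsilon> m"
    using above_alternation_linear by blast
  then show ?thesis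
    by cases (use weaken above_alternation_fibre_shift[OF assms(1) \<epsilon>] in blast)+
qed

definition nearly_above :: "real \<Rightarrow> real \<Rightarrow> nat \<Rightarrow> 'i \<Rightarrow> bool" where
  "nearly_above \<mu> \<Delta> m q \<longleftrightarrow> (\<forall>\<delta>. 0 < \<delta> \<and> \<delta> < \<Delta> \<longrightarrow> b \<in> above_alternation (fibre q) \<mu> \<delta> m)"

lemma nearly_above_SucI:
  assumes "nearly_above \<mu> \<Delta> m q" "(- 1) ^ m * (fibre q b - \<mu>) = \<Delta>"
  shows "nearly_above \<mu> \<Delta> (Suc m) q"
  using assms unfolding nearly_above_def by (blast intro: above_alternation_SucI less_imp_le)

lemma nearly_above_between:
  assumes "nearly_above \<mu> \<Delta> m i" "nearly_above \<mu> \<Delta> m j"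
  shows "nearly_above \<mu> \<Delta> m c"
  unfolding nearly_above_def
proof (intro allI impI)
  fix \<delta> assume "0 < \<delta> \<and> \<delta> < \<Delta>"
  then obtain \<epsilon> where "0 < \<delta>" "\<delta> < \<epsilon>" "\<epsilon> < \<Delta>"
    using dense by blast
  moreover from this have "b \<in> above_alternation (fibre q) \<mu> \<epsilon> m" if "q \<in> {i, j}" for q
    using assms that unfolding nearly_above_def by auto
  ultimately show "b \<in> above_alternation (fibre c) \<mu> \<delta> m"
    using above_alternation_fibre_monotone[of \<delta> \<epsilon> \<mu> m] by auto
qed

lemma nearly_above_of_between:
  assumes "nearly_above \<mu> \<Delta> m c" "q \<in> {i, j}"
  shows "nearly_above \<mu> \<Delta> m q"
  unfolding nearly_above_def
proof (intro allI impI)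
  fix \<delta> assume "0 < \<delta> \<and> \<delta> < \<Delta>"
  then obtain \<epsilon> \<epsilon>' where \<epsilon>: "0 < \<delta>" "\<delta> < \<epsilon>" "\<epsilon> < \<epsilon>'" "\<epsilon>' < \<Delta>"
    using dense by metis
  then have "b \<in> above_alternation (fibre c) \<mu> \<epsilon>' m"
    using assms(1) unfolding nearly_above_def by auto
  then obtain q' where "q' \<in> {i, j}" "b \<in> above_alternation (fibre q') \<mu> \<epsilon> m"
    using above_alternation_fibre_monotone[of \<epsilon> \<epsilon>' \<mu> m] \<epsilon> by auto
  then show "b \<in> above_alternation (fibre q) \<mu> \<delta> m"
    using assms(2) \<epsilon> by (auto intro: above_alternation_fibre_transfer)
qed

lemma fibre_c_eq_fibre_i: "fibre c b = fibre i b"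
proof (rule ccontr)
  assume "fibre c b \<noteq> fibre i b"
  define \<mu> where "\<mu> = (fibre i b + fibre c b) / 2"
  define \<Delta> where "\<Delta> = \<bar>fibre i b - \<mu>\<bar>"
  have "\<Delta> > 0"
    using \<open>fibre c b \<noteq> fibre i b\<close> by (simp add: \<Delta>_def \<mu>_def field_simps)
  have turn: "(- 1) ^ m * (fibre i b - \<mu>) = \<Delta> \<and> (- 1) ^ m * (fibre j b - \<mu>) = \<Delta> \<or>
      (- 1) ^ m * (fibre c b - \<mu>) = \<Delta>" for m
    unfolding \<Delta>_def \<mu>_def fibre_i_eq_fibre_j[symmetric]
    by (cases "even m") (auto simp: field_simps abs_if)
  have "nearly_above \<mu> \<Delta> m i \<and> nearly_above \<mu> \<Delta> m c \<and> nearly_above \<mu> \<Delta> m j" for m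
  proof (induction m)
    case 0
    show ?case
      using b by (simp add: nearly_above_def)
  next
    case (Suc m)
    from turn[of m] show ?case
    proof
      assume "(- 1) ^ m * (fibre i b - \<mu>) = \<Delta> \<and> (- 1) ^ m * (fibre j b - \<mu>) = \<Delta>"
      then have "nearly_above \<mu> \<Delta> (Suc m) i" "nearly_above \<mu> \<Delta> (Suc m) j"
        using Suc by (auto intro: nearly_above_SucI)
      then show ?thesis
        using nearly_above_between by blast
    next
      assume "(- 1) ^ m * (fibre c b - \<mu>) = \<Delta>"
      then have "nearly_above \<mu> \<Delta> (Suc m) c"
        using Suc by (auto intro: nearly_above_SucI)
      then show ?thesis
        using nearly_above_of_between by blast
    qed
  qed
  then have "b \<in> above_alternation (fibre i) \<mu> (\<Delta> / 2) m" for m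
    using \<open>\<Delta> > 0\<close> unfolding nearly_above_def by simp
  moreover have "valuation (a \<circ> id(c := i)) \<in> (S \<times> {..<n} <+> B) \<rightarrow> univ M"
    using S(1) i B by (intro valuation_in_univ) auto
  from above_alternation_slice_eventually_empty[OF weakly_o_minimal definable this]
  obtain N where "above_alternation (fibre i) \<mu> (\<Delta> / 2) N = {}"
    using \<open>\<Delta> > 0\<close> unfolding fibre_def by (metis half_gt_zero)
  ultimately show False by blast
qed

end

context cut_parameter
begin

lemma definable_eq_off_cut:
  assumes F: "definable (S \<times> {..<n} <+> insert b B) F" and S: "finite S" "S \<subseteq> I1 \<union> {c} \<union> I2"
  shows "\<exists>i\<in>I1. (\<forall>s\<in>S \<inter> I1. s < i) \<and> F (valuation (a \<circ> id(c := i))) = F (valuation a)"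
proof -
  obtain i j where bounds: "i \<in> I1" "\<forall>s\<in>S \<inter> I1. s < i" "j \<in> I2" "\<forall>s\<in>S \<inter> I2. j < s"
    using S(1) by (rule ex_bounds)
  define \<tau> where "\<tau> s = (if s = Inr b then None else Some s)" for s :: "'i \<times> nat + 'm"
  have "definable (adjoin (S \<times> {..<n} <+> B)) (\<lambda>e. F (e \<circ> \<tau>))"
    using F by (rule definable_reindex) (auto simp: \<tau>_def)
  then interpret cut_family L M r R I1 I2 c n a B b "\<lambda>e. F (e \<circ> \<tau>)" S i j
    using S(2) bounds by unfold_locales auto
  have "case_option b (valuation d) \<circ> \<tau> = valuation d" for d :: "'i \<Rightarrow> 'm list"
    by (auto simp: \<tau>_def valuation_def)
  then have "fibre q b = F (valuation (a \<circ> id(c := q)))" for q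
    by (simp add: fibre_def slice_def)
  then have "F (valuation (a \<circ> id(c := i))) = F (valuation a)"
    using fibre_c_eq_fibre_i by (simp add: fun_upd_idem)
  with bounds show ?thesis by blast
qed

lemma definable_eq_strict_mono_off_cut:
  assumes F: "definable (S \<times> {..<n} <+> insert b B) F" and "finite S"
    and g: "strict_mono_on S g" "g ` S \<subseteq> I1 \<union> {c} \<union> I2"
  obtains h where "strict_mono_on S h" "h ` S \<subseteq> I1 \<union> I2"
    "F (valuation (a \<circ> h)) = F (valuation (a \<circ> g))"
proof -
  have reindexed: "definable (g ` S \<times> {..<n} <+> insert b B) (\<lambda>e. F (e \<circ> map_sum (map_prod g id) id))"
    using F by (rule definable_reindex) auto
  obtain i where i: "i \<in> I1" "\<forall>s\<in>g ` S \<inter> I1. s < i"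
    and eq: "F (valuation (a \<circ> id(c := i) \<circ> g)) = F (valuation (a \<circ> g))"
    using definable_eq_off_cut[OF reindexed _ g(2)] \<open>finite S\<close> unfolding valuation_reindex by auto
  have "strict_mono_on S (id(c := i) \<circ> g)"
  proof (rule strict_mono_onI)
    fix k k' assume k: "k \<in> S" "k' \<in> S" "k < k'"
    then have "g k < g k'"
      by (rule strict_mono_onD[OF g(1)])
    moreover have "g k \<in> I1" if "g k < c"
      using that k(1) g(2) I2(2) by (auto dest: less_asym)
    ultimately show "(id(c := i) \<circ> g) k < (id(c := i) \<circ> g) k'"
      using i k I1(2)[OF i(1)] by auto
  qed
  moreover have "(id(c := i) \<circ> g) ` S \<subseteq> I1 \<union> I2"
    using g(2) i(1) by auto
  ultimately show ?thesis
    using that eq unfolding comp_assoc by blast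
qed

lemma indiscernible_insert: "indiscernible L M (insert b B) (I1 \<union> {c} \<union> I2) a"
proof (rule indiscernibleI[OF length_a])
  fix l g h F
  assume g: "strict_mono_on {..<l::nat} g" "g ` {..<l} \<subseteq> I1 \<union> {c} \<union> I2"
    and h: "strict_mono_on {..<l} h" "h ` {..<l} \<subseteq> I1 \<union> {c} \<union> I2"
    and F: "definable ({..<l} \<times> {..<n} <+> insert b B) F"
  obtain g' where g': "strict_mono_on {..<l} g'" "g' ` {..<l} \<subseteq> I1 \<union> I2"
    "F (valuation (a \<circ> g')) = F (valuation (a \<circ> g))"
    using F finite_lessThan g by (rule definable_eq_strict_mono_off_cut)
  obtain h' where h': "strict_mono_on {..<l} h'" "h' ` {..<l} \<subseteq> I1 \<union> I2"
    "F (valuation (a \<circ> h')) = F (valuation (a \<circ> h))"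
    using F finite_lessThan h by (rule definable_eq_strict_mono_off_cut)
  show "F (valuation (a \<circ> g)) = F (valuation (a \<circ> h))"
    using indiscernible_definable[OF indiscernible_b length_a g'(1,2) h'(1,2) F] g'(3) h'(3) by simp
qed

end

lemma (in cut_sequence) indiscernible_if_indiscernible_off_cut:
  assumes "B \<subseteq> univ M" "indiscernible L M {} (I1 \<union> {c} \<union> I2) a"
    and "indiscernible L M B (I1 \<union> I2) a"
  shows "indiscernible L M B (I1 \<union> {c} \<union> I2) a"
proof (rule indiscernible_if_finite_subsets)
  fix B' assume "finite B'" "B' \<subseteq> B"
  then show "indiscernible L M B' (I1 \<union> {c} \<union> I2) a"
  proof (induction B' rule: finite_induct)
    case empty
    show ?case by (rule assms(2))
  next
    case (insert b B')
    then interpret cut_parameter L M r R I1 I2 c n a B' b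
      using assms(1) indiscernible_mono[OF assms(3) insert.prems] by unfold_locales auto
    show ?case by (rule indiscernible_insert)
  qed
qed

theorem theorem7p15:
  fixes L :: "('f, 'p) cl_lang" and r :: 'p and T :: "('f, 'p) cl_fm set"
  assumes "is_lang L" and "is_theory L T"
    and "expands_MLO TYPE('m) L r T"
    and "\<And>(M :: ('f, 'p, 'm) cl_struct) R.
           is_model L T M \<Longrightarrow> MLO_order r M R \<Longrightarrow> weakly_o_minimal L R M"
  shows "distal TYPE('m) TYPE('i::linorder) L T"
  unfolding distal_def
proof (intro allI impI, elim conjE)
  fix M :: "('f, 'p, 'm) cl_struct" and I1 I2 :: "'i set" and c :: 'i and n a B
  assume M: "is_model L T M" and I1: "infinite I1" "\<forall>i\<in>I1. i < c" "\<forall>i\<in>I1. \<exists>j\<in>I1. i < j"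
    and I2: "infinite I2" "\<forall>i\<in>I2. c < i" "\<forall>i\<in>I2. \<exists>j\<in>I2. j < i"
    and a: "\<forall>i \<in> I1 \<union> {c} \<union> I2. a i \<in> tuples M n" and B: "B \<subseteq> univ M"
    and ind: "indiscernible L M {} (I1 \<union> {c} \<union> I2) a" "indiscernible L M B (I1 \<union> I2) a"
  obtain R where r: "r \<in> Preds L" "parity L r = 2" and R: "MLO_order r M R"
    using assms(3) M unfolding expands_MLO_def by metis
  have struct: "is_struct L M"
    using M unfolding is_model_def by (rule conjunct1)
  interpret cut_sequence L M r R I1 I2 c n a
  proof unfold_locales
    show "I1 \<noteq> {}" "I2 \<noteq> {}"
      using I1(1) I2(1) by auto
  qed (use assms(1) struct r R assms(4)[OF M R] I1 I2 a in auto)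
  show "indiscernible L M B (I1 \<union> {c} \<union> I2) a"
    using B ind by (rule indiscernible_if_indiscernible_off_cut)
qed

end
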